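(* 1. Let $R$ be a centrally essential ring. If $R$ is a left or right semi-Artinian ring, then $R/J(R)$ is a commutative regular ring. 2. Let $R$ be a centrally essential ring with center $C$. If $R$ is a right nonsingular ring or $C$ is a semiprime ring, then $R$ is a commutative ring. 3. If $R$ is a centrally essential ring and $B$ is a proper ideal of $R$ generated by some central idempotents such that the factor ring $R/B$ does not have nontrivial idempotents, then $R/B$ is not necessarily a centrally essential ring; that is, there exist a centrally essential ring $R$ and a proper ideal $B$ of $R$ generated by some set of central idempotents of $R$ such that $R/B$ has no idempotents other than $0$ and $1$ and $R/B$ is not centrally essential.
   Context: All rings are associative and unital, not necessarily commutative. A ring $R$ with center $C$ is called centrally essential if the right $C$-module $R_C$ is an essential extension of its submodule $C_C$; equivalently, for every nonzero $r\in R$ there is $c\in C$ with $0\neq rc\in C$. $J(R)$ is the Jacobson radical of $R$. A ring $R$ is regular if $a\in aRa$ for every $a\in R$. The socle of a module $M$ is the sum of all its simple submodules (and is $0$ if there are none). A module $M$ is semi-Artinian if every factor module of $M$ is an essential extension of its socle; a ring $R$ is right (left) semi-Artinian if the module $R_R$ (respectively ${}_RR$) is semi-Artinian. A ring $R$ is right nonsingular if it has no nonzero elements whose right annihilators are essential right ideals. A ring is semiprime if it has no nonzero nilpotent two-sided ideals. *)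

theory Defs
  imports "HOL-Algebra.Module" "HOL-Algebra.QuotRing" "HOL-Algebra.Ideal_Product"
begin

section \<open>Modules over a not necessarily commutative ring\<close>

text \<open>
  The library locale for modules assumes a commutative ring of scalars, but the record type of
  modules and the locale \<^locale>\<open>submodule\<close> do not.  A right module is represented by the same
  record, the scalar \<open>a\<close> acting by \<open>a \<odot> x = x \<cdot> a\<close>; so \<open>submodule I R (right_regular R)\<close>
  says that \<open>I\<close> is a right ideal.
\<close>

definition right_regular :: "('a, 'm) ring_scheme \<Rightarrow> ('a, 'a) module" where
  "right_regular R = \<lparr>carrier = carrier R, mult = mult R, one = one R, zero = zero R,
     add = add R, smult = (\<lambda>a x. x \<otimes>\<^bsub>R\<^esub> a)\<rparr>"

definition left_regular :: "('a, 'm) ring_scheme \<Rightarrow> ('a, 'a) module" where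
  "left_regular R = \<lparr>carrier = carrier R, mult = mult R, one = one R, zero = zero R,
     add = add R, smult = (\<lambda>a x. a \<otimes>\<^bsub>R\<^esub> x)\<rparr>"

text \<open>
  The multiplication and the unit carried by a module record play no role; in a factor module
  they are filled in as for factor rings.
\<close>

definition factor_module :: "('b, 'c, 'm) module_scheme \<Rightarrow> 'c set \<Rightarrow> ('b, 'c set) module" where
  "factor_module M N = \<lparr>carrier = a_rcosets\<^bsub>M\<^esub> N, mult = rcoset_mult M N,
     one = N +>\<^bsub>M\<^esub> \<one>\<^bsub>M\<^esub>, zero = N, add = set_add M,
     smult = (\<lambda>a X. \<Union>x\<in>X. N +>\<^bsub>M\<^esub> (a \<odot>\<^bsub>M\<^esub> x))\<rparr>"

definition essential_submodule ::
    "'c set \<Rightarrow> ('b, 'r) ring_scheme \<Rightarrow> ('b, 'c, 'm) module_scheme \<Rightarrow> bool" where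
  "essential_submodule N R M \<longleftrightarrow> submodule N R M \<and>
     (\<forall>H. submodule H R M \<and> H \<noteq> {\<zero>\<^bsub>M\<^esub>} \<longrightarrow> N \<inter> H \<noteq> {\<zero>\<^bsub>M\<^esub>})"

definition simple_submodule ::
    "'c set \<Rightarrow> ('b, 'r) ring_scheme \<Rightarrow> ('b, 'c, 'm) module_scheme \<Rightarrow> bool" where
  "simple_submodule S R M \<longleftrightarrow> submodule S R M \<and> S \<noteq> {\<zero>\<^bsub>M\<^esub>} \<and>
     (\<forall>H. submodule H R M \<and> H \<subseteq> S \<longrightarrow> H = {\<zero>\<^bsub>M\<^esub>} \<or> H = S)"

text \<open>
  A sum of submodules is the least submodule containing all of them; it is the zero submodule if
  the family is empty.
\<close>

definition socle ::
    "('b, 'r) ring_scheme \<Rightarrow> ('b, 'c, 'm) module_scheme \<Rightarrow> 'c set" where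
  "socle R M = \<Inter>{H. submodule H R M \<and> (\<forall>S. simple_submodule S R M \<longrightarrow> S \<subseteq> H)}"

definition semiartinian_module ::
    "('b, 'r) ring_scheme \<Rightarrow> ('b, 'c, 'm) module_scheme \<Rightarrow> bool" where
  "semiartinian_module R M \<longleftrightarrow> (\<forall>N. submodule N R M \<longrightarrow>
     essential_submodule (socle R (factor_module M N)) R (factor_module M N))"


section \<open>Ring-theoretic notions\<close>

definition right_semiartinian :: "('a, 'm) ring_scheme \<Rightarrow> bool" where
  "right_semiartinian R \<longleftrightarrow> semiartinian_module R (right_regular R)"

definition left_semiartinian :: "('a, 'm) ring_scheme \<Rightarrow> bool" where
  "left_semiartinian R \<longleftrightarrow> semiartinian_module R (left_regular R)"

definition ring_center :: "('a, 'm) ring_scheme \<Rightarrow> 'a set" where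
  "ring_center R = {c \<in> carrier R. \<forall>r\<in>carrier R. c \<otimes>\<^bsub>R\<^esub> r = r \<otimes>\<^bsub>R\<^esub> c}"

definition center_ring :: "('a, 'm) ring_scheme \<Rightarrow> ('a, 'm) ring_scheme" where
  "center_ring R = R\<lparr>carrier := ring_center R\<rparr>"

text \<open>
  The module \<open>R\<^sub>C\<close> has the same record as \<open>R\<^sub>R\<close>; only the ring of scalars is restricted to the
  center.
\<close>

definition centrally_essential :: "('a, 'm) ring_scheme \<Rightarrow> bool" where
  "centrally_essential R \<longleftrightarrow>
     essential_submodule (ring_center R) (center_ring R) (right_regular R)"

definition maximal_right_ideal :: "'a set \<Rightarrow> ('a, 'm) ring_scheme \<Rightarrow> bool" where
  "maximal_right_ideal I R \<longleftrightarrow> submodule I R (right_regular R) \<and> I \<noteq> carrier R \<and>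
     (\<forall>H. submodule H R (right_regular R) \<and> I \<subseteq> H \<longrightarrow> H = I \<or> H = carrier R)"

definition jacobson_radical :: "('a, 'm) ring_scheme \<Rightarrow> 'a set" where
  "jacobson_radical R = {x \<in> carrier R. \<forall>I. maximal_right_ideal I R \<longrightarrow> x \<in> I}"

definition regular_ring :: "('a, 'm) ring_scheme \<Rightarrow> bool" where
  "regular_ring R \<longleftrightarrow>
     (\<forall>a\<in>carrier R. \<exists>x\<in>carrier R. a = a \<otimes>\<^bsub>R\<^esub> x \<otimes>\<^bsub>R\<^esub> a)"

definition right_annihilator :: "('a, 'm) ring_scheme \<Rightarrow> 'a \<Rightarrow> 'a set" where
  "right_annihilator R a = {x \<in> carrier R. a \<otimes>\<^bsub>R\<^esub> x = \<zero>\<^bsub>R\<^esub>}"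

definition right_nonsingular :: "('a, 'm) ring_scheme \<Rightarrow> bool" where
  "right_nonsingular R \<longleftrightarrow> (\<forall>a\<in>carrier R.
     essential_submodule (right_annihilator R a) R (right_regular R) \<longrightarrow> a = \<zero>\<^bsub>R\<^esub>)"

primrec ideal_power :: "('a, 'm) ring_scheme \<Rightarrow> 'a set \<Rightarrow> nat \<Rightarrow> 'a set" where
  "ideal_power R I 0 = carrier R"
| "ideal_power R I (Suc n) = ideal_prod R I (ideal_power R I n)"

definition semiprime_ring :: "('a, 'm) ring_scheme \<Rightarrow> bool" where
  "semiprime_ring R \<longleftrightarrow>
     (\<forall>I. ideal I R \<and> (\<exists>n. ideal_power R I n = {\<zero>\<^bsub>R\<^esub>}) \<longrightarrow> I = {\<zero>\<^bsub>R\<^esub>})"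

definition idempotents :: "('a, 'm) ring_scheme \<Rightarrow> 'a set" where
  "idempotents R = {e \<in> carrier R. e \<otimes>\<^bsub>R\<^esub> e = e}"


section \<open>Elementary descriptions\<close>

lemma submodule_right_regular_iff:
  assumes "ring R" and "carrier A \<subseteq> carrier R"
  shows "submodule H A (right_regular R) \<longleftrightarrow>
    additive_subgroup H R \<and> (\<forall>a\<in>carrier A. \<forall>x\<in>H. x \<otimes>\<^bsub>R\<^esub> a \<in> H)"
proof -
  have "subgroup H (add_monoid (right_regular R)) = subgroup H (add_monoid R)"
    by (simp add: subgroup_def m_inv_def right_regular_def)
  then show ?thesis
    by (simp add: submodule_def submodule_axioms_def additive_subgroup_def)
       (auto simp: right_regular_def)
qed

lemma submodule_left_regular_iff:
  assumes "ring R"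
  shows "submodule H R (left_regular R) \<longleftrightarrow>
    additive_subgroup H R \<and> (\<forall>a\<in>carrier R. \<forall>x\<in>H. a \<otimes>\<^bsub>R\<^esub> x \<in> H)"
proof -
  have "subgroup H (add_monoid (left_regular R)) = subgroup H (add_monoid R)"
    by (simp add: subgroup_def m_inv_def left_regular_def)
  then show ?thesis
    by (simp add: submodule_def submodule_axioms_def additive_subgroup_def)
       (auto simp: left_regular_def)
qed

lemma ring_center_additive_subgroup:
  assumes "ring R"
  shows "additive_subgroup (ring_center R) R"
proof -
  interpret ring R by fact
  show ?thesis
  proof (rule additive_subgroup.intro, rule add.subgroupI)
    show "ring_center R \<subseteq> carrier R" by (auto simp: ring_center_def)
    show "ring_center R \<noteq> {}" by (auto simp: ring_center_def intro!: exI[of _ "\<zero>\<^bsub>R\<^esub>"])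
  qed (auto simp: ring_center_def l_minus r_minus l_distr r_distr simp flip: a_inv_def)
qed

lemma ring_center_mult:
  assumes "ring R" "c \<in> ring_center R" "d \<in> ring_center R"
  shows "c \<otimes>\<^bsub>R\<^esub> d \<in> ring_center R"
proof -
  interpret ring R by fact
  have c: "c \<in> carrier R" "\<And>r. r \<in> carrier R \<Longrightarrow> c \<otimes>\<^bsub>R\<^esub> r = r \<otimes>\<^bsub>R\<^esub> c"
    and d: "d \<in> carrier R" "\<And>r. r \<in> carrier R \<Longrightarrow> d \<otimes>\<^bsub>R\<^esub> r = r \<otimes>\<^bsub>R\<^esub> d"
    using assms by (auto simp: ring_center_def)
  have *: "c \<otimes>\<^bsub>R\<^esub> d \<otimes>\<^bsub>R\<^esub> r = r \<otimes>\<^bsub>R\<^esub> (c \<otimes>\<^bsub>R\<^esub> d)" if r: "r \<in> carrier R" for r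
    by (metis c d r m_assoc)
  show ?thesis
    unfolding ring_center_def using * c(1) d(1) by blast
qed

lemma centrally_essential_iff:
  assumes "ring R"
  shows "centrally_essential R \<longleftrightarrow>
    (\<forall>r\<in>carrier R. r \<noteq> \<zero>\<^bsub>R\<^esub> \<longrightarrow>
      (\<exists>c\<in>ring_center R. r \<otimes>\<^bsub>R\<^esub> c \<noteq> \<zero>\<^bsub>R\<^esub> \<and> r \<otimes>\<^bsub>R\<^esub> c \<in> ring_center R))"
    (is "_ \<longleftrightarrow> ?E")
proof -
  interpret ring R by fact
  let ?C = "ring_center R"
  have car: "carrier (center_ring R) = ?C" by (simp add: center_ring_def)
  have sub: "?C \<subseteq> carrier R" by (auto simp: ring_center_def)
  have smod: "submodule H (center_ring R) (right_regular R) \<longleftrightarrow>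
      additive_subgroup H R \<and> (\<forall>a\<in>?C. \<forall>x\<in>H. x \<otimes>\<^bsub>R\<^esub> a \<in> H)" for H
    using submodule_right_regular_iff[OF \<open>ring R\<close>] car sub by metis
  have zero: "\<zero>\<^bsub>right_regular R\<^esub> = \<zero>\<^bsub>R\<^esub>" by (simp add: right_regular_def)
  have one: "\<one>\<^bsub>R\<^esub> \<in> ?C" by (simp add: ring_center_def)
  have C: "submodule ?C (center_ring R) (right_regular R)"
    unfolding smod
    by (intro conjI ballI ring_center_additive_subgroup ring_center_mult \<open>ring R\<close>)
  show ?thesis
  proof
    assume ce: "centrally_essential R"
    show ?E
    proof (intro ballI impI)
      fix r assume r: "r \<in> carrier R" "r \<noteq> \<zero>\<^bsub>R\<^esub>"
      let ?H = "(\<lambda>c. r \<otimes>\<^bsub>R\<^esub> c) ` ?C"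
      interpret C: additive_subgroup ?C R
        using ring_center_additive_subgroup[OF \<open>ring R\<close>] .
      have "additive_subgroup ?H R"
      proof (rule additive_subgroup.intro, rule add.subgroupI)
        show "?H \<subseteq> carrier R" using r sub by auto
        show "?H \<noteq> {}" using one by auto
        show "\<ominus>\<^bsub>R\<^esub> x \<in> ?H" if x: "x \<in> ?H" for x
        proof -
          obtain c where c: "c \<in> ?C" "x = r \<otimes>\<^bsub>R\<^esub> c" using x by auto
          then have "\<ominus>\<^bsub>R\<^esub> x = r \<otimes>\<^bsub>R\<^esub> (\<ominus>\<^bsub>R\<^esub> c)" using r sub by (auto simp: r_minus)
          then show ?thesis using C.a_inv_closed c by (auto simp flip: a_inv_def)
        qed
        show "x \<oplus>\<^bsub>R\<^esub> y \<in> ?H" if xy: "x \<in> ?H" "y \<in> ?H" for x y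
        proof -
          obtain c d where cd: "c \<in> ?C" "x = r \<otimes>\<^bsub>R\<^esub> c" "d \<in> ?C" "y = r \<otimes>\<^bsub>R\<^esub> d"
            using xy by auto
          then have "x \<oplus>\<^bsub>R\<^esub> y = r \<otimes>\<^bsub>R\<^esub> (c \<oplus>\<^bsub>R\<^esub> d)" using r sub by (auto simp: r_distr)
          then show ?thesis using C.a_closed cd by auto
        qed
      qed
      moreover have "x \<otimes>\<^bsub>R\<^esub> a \<in> ?H" if xa: "a \<in> ?C" "x \<in> ?H" for a x
      proof -
        obtain c where c: "c \<in> ?C" "x = r \<otimes>\<^bsub>R\<^esub> c" using xa by auto
        then have "x \<otimes>\<^bsub>R\<^esub> a = r \<otimes>\<^bsub>R\<^esub> (c \<otimes>\<^bsub>R\<^esub> a)" using r sub xa by (auto intro: m_assoc)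
        then show ?thesis using ring_center_mult[OF \<open>ring R\<close> c(1) xa(1)] by auto
      qed
      ultimately have "submodule ?H (center_ring R) (right_regular R)"
        unfolding smod by blast
      moreover have "r \<in> ?H" using one r by (auto intro!: image_eqI[of _ _ "\<one>\<^bsub>R\<^esub>"])
      ultimately have "?C \<inter> ?H \<noteq> {\<zero>\<^bsub>R\<^esub>}"
        using ce r unfolding centrally_essential_def essential_submodule_def zero by blast
      moreover have "\<zero>\<^bsub>R\<^esub> \<in> ?C \<inter> ?H"
        using C.zero_closed r by (auto intro!: image_eqI[of _ _ "\<zero>\<^bsub>R\<^esub>"])
      ultimately show "\<exists>c\<in>?C. r \<otimes>\<^bsub>R\<^esub> c \<noteq> \<zero>\<^bsub>R\<^esub> \<and> r \<otimes>\<^bsub>R\<^esub> c \<in> ?C" by blast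
    qed
  next
    assume E: ?E
    show "centrally_essential R"
      unfolding centrally_essential_def essential_submodule_def zero
    proof (intro conjI C allI impI)
      fix H assume H: "submodule H (center_ring R) (right_regular R) \<and> H \<noteq> {\<zero>\<^bsub>R\<^esub>}"
      then have ag: "additive_subgroup H R" and cl: "\<forall>a\<in>?C. \<forall>x\<in>H. x \<otimes>\<^bsub>R\<^esub> a \<in> H"
        unfolding smod by auto
      obtain r where r: "r \<in> H" "r \<noteq> \<zero>\<^bsub>R\<^esub>"
        using additive_subgroup.zero_closed[OF ag] H by blast
      then show "?C \<inter> H \<noteq> {\<zero>\<^bsub>R\<^esub>}"
        using E cl additive_subgroup.a_subset[OF ag] by blast
    qed
  qed
qed

lemma factor_module_smult:
  assumes R: "ring R" and N: "submodule N R (right_regular R)"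
    and a: "a \<in> carrier R" and x: "x \<in> carrier R"
  shows "a \<odot>\<^bsub>factor_module (right_regular R) N\<^esub> (N +>\<^bsub>R\<^esub> x) = N +>\<^bsub>R\<^esub> (x \<otimes>\<^bsub>R\<^esub> a)"
proof -
  interpret ring R by fact
  have ag: "additive_subgroup N R" and cl: "\<And>y. y \<in> N \<Longrightarrow> y \<otimes>\<^bsub>R\<^esub> a \<in> N"
    using N a submodule_right_regular_iff[OF R, of R N] by auto
  interpret N: abelian_subgroup N R
    using ag by (rule abelian_subgroupI3) (rule is_abelian_group)
  have cos: "N +>\<^bsub>right_regular R\<^esub> y = N +>\<^bsub>R\<^esub> y" for y
    by (simp add: a_r_coset_def' right_regular_def)
  have "N +>\<^bsub>R\<^esub> (y \<otimes>\<^bsub>R\<^esub> a) = N +>\<^bsub>R\<^esub> (x \<otimes>\<^bsub>R\<^esub> a)" if y: "y \<in> N +>\<^bsub>R\<^esub> x" for y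
  proof -
    obtain n where n: "n \<in> N" "y = n \<oplus>\<^bsub>R\<^esub> x"
      using y by (auto simp: a_r_coset_def')
    then have nc: "n \<in> carrier R" using N.a_subset by auto
    have "y \<otimes>\<^bsub>R\<^esub> a \<in> N +>\<^bsub>R\<^esub> (x \<otimes>\<^bsub>R\<^esub> a)"
      using n nc cl a x by (auto simp: a_r_coset_def' l_distr)
    then show ?thesis
      using a x by (metis N.a_repr_independence' m_closed)
  qed
  moreover have "x \<in> N +>\<^bsub>R\<^esub> x" using x N.a_rcos_self by blast
  ultimately have "(\<Union>y\<in>N +>\<^bsub>R\<^esub> x. N +>\<^bsub>R\<^esub> (y \<otimes>\<^bsub>R\<^esub> a)) = N +>\<^bsub>R\<^esub> (x \<otimes>\<^bsub>R\<^esub> a)"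
    by blast
  moreover have "b \<odot>\<^bsub>right_regular R\<^esub> y = y \<otimes>\<^bsub>R\<^esub> b" for b y
    by (simp add: right_regular_def)
  ultimately show ?thesis
    by (simp add: factor_module_def cos)
qed

end

theory Submission
  imports Defs "HOL-Algebra.Multiplicative_Group"
begin

text \<open>
  For an element \<open>a\<close> of a centrally essential ring \<open>R\<close> with center \<open>C\<close>, let \<open>L\<^sub>a\<close> be the set of those
  \<open>c \<in> C\<close> with \<open>a c \<in> C\<close>.  Two facts about \<open>L\<^sub>a\<close> carry both positive statements.  Every commutator
  \<open>a b - b a\<close> is annihilated by \<open>L\<^sub>a\<close>, because \<open>a b c = (a c) b = b (a c)\<close>.  And \<open>L\<^sub>a\<close> is large: every
  nonzero element of \<open>R\<close> has a nonzero central multiple in \<open>L\<^sub>a\<close>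
  (\<open>central_denominators_essential\<close>).

  If \<open>C\<close> is reduced, this already gives commutativity: a nonzero commutator would have a nonzero
  multiple \<open>w \<in> L\<^sub>a\<close>, and \<open>w\<^sup>2 = 0\<close>.  Both hypotheses of the second statement force \<open>C\<close> to be
  reduced, since a central element of square zero generates a nilpotent ideal of \<open>C\<close> and has an
  essential right annihilator in \<open>R\<close>.

  The semi-Artinian condition on the right enters through simple covers: over every proper right
  ideal \<open>N\<close> there is a right ideal \<open>T\<close> with \<open>T / N\<close> simple.  Choosing \<open>N\<close> maximal among the right ideals that
  avoid a given set \<open>F\<close>, one finds \<open>f \<in> F\<close> such that the \<open>r\<close> with \<open>f r \<in> N\<close> form a maximal right
  ideal (\<open>simple_cover_principle\<close>).  Applied to three sets \<open>F\<close> this yields the first statement: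
  with the powers of an element of \<open>J(R)\<close>, that \<open>J(R)\<close> is nil; with \<open>d R - J(R)\<close> for a commutator
  \<open>d \<notin> J(R)\<close>, an idempotent modulo \<open>J(R)\<close> inside \<open>d R\<close>, which is nonzero modulo \<open>J(R)\<close> although
  its annihilation by \<open>L\<^sub>a\<close> makes it nilpotent, so that \<open>R / J(R)\<close> is commutative; and with the
  elements \<open>a\<^sup>n (1 - a x)\<close>, that one of them lies in \<open>J(R)\<close>, so that \<open>R / J(R)\<close> is regular.
  The outcome, a nil ideal with commutative regular quotient, is a left-right symmetric notion and
  determines the ideal as \<open>J(R)\<close>; so the left semi-Artinian case follows by passing to the opposite
  ring.

  For the counterexample, let \<open>A\<close> be a centrally essential algebra containing a subalgebra \<open>A\<^sub>0\<close>
  that is not centrally essential and has only the trivial idempotents.  The sequences in \<open>A\<close> that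
  are eventually constant with value in \<open>A\<^sub>0\<close> form a centrally essential ring, because a nonzero
  entry can be treated at its own position, where all of \<open>A\<close> is available.  The eventually zero
  sequences form the ideal generated by the central idempotents supported at one position, and the
  quotient is \<open>A\<^sub>0\<close>.
\<close>


section \<open>Right ideals and the center\<close>

abbreviation right_ideal :: "('a, 'm) ring_scheme \<Rightarrow> 'a set \<Rightarrow> bool" where
  "right_ideal R I \<equiv> submodule I R (right_regular R)"

lemma center_ring_simps [simp]:
  "carrier (center_ring R) = ring_center R" "mult (center_ring R) = mult R"
  "add (center_ring R) = add R" "zero (center_ring R) = zero R" "one (center_ring R) = one R"
  by (simp_all add: center_ring_def)

context ring
begin

lemma right_idealI:
  assumes "I \<subseteq> carrier R" "\<zero> \<in> I"
    and add: "\<And>x y. x \<in> I \<Longrightarrow> y \<in> I \<Longrightarrow> x \<oplus> y \<in> I"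
    and mult: "\<And>x r. x \<in> I \<Longrightarrow> r \<in> carrier R \<Longrightarrow> x \<otimes> r \<in> I"
  shows "right_ideal R I"
proof -
  have "\<ominus> x \<in> I" if "x \<in> I" for x
    using mult[OF that, of "\<ominus> \<one>"] that assms(1) by (auto simp: r_minus)
  then have "additive_subgroup I R"
    using assms by (intro additive_subgroup.intro add.subgroupI) (auto simp flip: a_inv_def)
  then show ?thesis
    using submodule_right_regular_iff[OF ring_axioms, of R I] mult by auto
qed

lemma right_idealD:
  assumes "right_ideal R I"
  shows right_ideal_subset: "I \<subseteq> carrier R"
    and right_ideal_zero: "\<zero> \<in> I"
    and right_ideal_add: "\<And>x y. x \<in> I \<Longrightarrow> y \<in> I \<Longrightarrow> x \<oplus> y \<in> I"
    and right_ideal_mult: "\<And>x r. x \<in> I \<Longrightarrow> r \<in> carrier R \<Longrightarrow> x \<otimes> r \<in> I"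
proof -
  have ag: "additive_subgroup I R" and m: "\<forall>a\<in>carrier R. \<forall>x\<in>I. x \<otimes> a \<in> I"
    using submodule_right_regular_iff[OF ring_axioms, of R I] assms by auto
  interpret additive_subgroup I R by (fact ag)
  show "I \<subseteq> carrier R" "\<zero> \<in> I" "\<And>x y. x \<in> I \<Longrightarrow> y \<in> I \<Longrightarrow> x \<oplus> y \<in> I"
    "\<And>x r. x \<in> I \<Longrightarrow> r \<in> carrier R \<Longrightarrow> x \<otimes> r \<in> I"
    using a_subset zero_closed m by auto
qed

lemma center_closed: "c \<in> ring_center R \<Longrightarrow> c \<in> carrier R"
  by (simp add: ring_center_def)

lemma center_commute:
  "c \<in> ring_center R \<Longrightarrow> r \<in> carrier R \<Longrightarrow> c \<otimes> r = r \<otimes> c"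
  by (simp add: ring_center_def)

end


section \<open>Commutators and central denominators\<close>

context ring
begin

text \<open>
  Written \<open>L\<^sub>a\<close> in comments.  If such a \<open>c\<close> is invertible, \<open>a\<close> is the fraction of central elements with
  numerator \<open>a c\<close> and denominator \<open>c\<close>.
\<close>

definition central_denominators :: "'a \<Rightarrow> 'a set" where
  "central_denominators a = {c \<in> ring_center R. a \<otimes> c \<in> ring_center R}"

text \<open>
  Since both \<open>c\<close> and \<open>a c\<close> commute with \<open>b\<close>: \<open>a b c = (a c) b = b (a c)\<close>.
\<close>

lemma commutator_central_denominator:
  assumes a: "a \<in> carrier R" and b: "b \<in> carrier R" and c: "c \<in> central_denominators a"
  shows "(a \<otimes> b \<ominus> b \<otimes> a) \<otimes> c = \<zero>"
proof -
  have cC: "c \<in> ring_center R" and acC: "a \<otimes> c \<in> ring_center R" and cR: "c \<in> carrier R"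
    using c by (auto simp: central_denominators_def center_closed)
  have "a \<otimes> b \<otimes> c = a \<otimes> c \<otimes> b"
    using a b cR center_commute[OF cC b] by (simp add: m_assoc)
  also have "\<dots> = b \<otimes> (a \<otimes> c)"
    by (rule center_commute[OF acC b])
  finally show ?thesis
    using a b cR by (simp add: a_minus_def l_distr l_minus m_assoc r_neg)
qed

text \<open>
  Central essentiality is used twice: a nonzero multiple \<open>r c\<close> of \<open>r\<close> is central, and unless
  \<open>a (r c)\<close> vanishes it has in turn a nonzero central multiple \<open>a (r c d)\<close>.
\<close>

lemma central_denominators_essential:
  assumes ce: "centrally_essential R" and a: "a \<in> carrier R"
    and r: "r \<in> carrier R" "r \<noteq> \<zero>"
  shows "\<exists>c\<in>ring_center R. r \<otimes> c \<noteq> \<zero> \<and> r \<otimes> c \<in> central_denominators a"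
proof -
  note E = ce[unfolded centrally_essential_iff[OF ring_axioms], rule_format]
  obtain c where c: "c \<in> ring_center R" "r \<otimes> c \<noteq> \<zero>" "r \<otimes> c \<in> ring_center R"
    using E[OF r] by blast
  show ?thesis
  proof (cases "a \<otimes> (r \<otimes> c) = \<zero>")
    case True
    then have "r \<otimes> c \<in> central_denominators a"
      using c by (simp add: central_denominators_def ring_center_def)
    then show ?thesis using c by blast
  next
    case False
    have cR: "c \<in> carrier R" using c center_closed by blast
    obtain d where d: "d \<in> ring_center R" "a \<otimes> (r \<otimes> c) \<otimes> d \<noteq> \<zero>"
      "a \<otimes> (r \<otimes> c) \<otimes> d \<in> ring_center R"
      using E[of "a \<otimes> (r \<otimes> c)"] False a r cR by auto
    have dR: "d \<in> carrier R" using d center_closed by blast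
    have eq: "a \<otimes> (r \<otimes> c) \<otimes> d = a \<otimes> (r \<otimes> (c \<otimes> d))" "r \<otimes> c \<otimes> d = r \<otimes> (c \<otimes> d)"
      using a r cR dR by (simp_all add: m_assoc)
    have "r \<otimes> (c \<otimes> d) \<in> ring_center R"
      using ring_center_mult[OF ring_axioms c(3) d(1)] eq by simp
    moreover have "r \<otimes> (c \<otimes> d) \<noteq> \<zero>"
      using d(2) a unfolding eq by auto
    ultimately show ?thesis
      using ring_center_mult[OF ring_axioms c(1) d(1)] d(3) unfolding eq central_denominators_def
      by blast
  qed
qed

text \<open>
  If \<open>d = a b - b a\<close> is nonzero, some multiple \<open>w = d c e\<close> with central \<open>c\<close> and \<open>e\<close> is a nonzero
  element of \<open>L\<^sub>a\<close>.  Then \<open>d w = 0\<close>, hence \<open>w\<^sup>2 = d w c e = 0\<close>.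
\<close>

proposition commutative_if_center_reduced:
  assumes ce: "centrally_essential R"
    and red: "\<And>c. c \<in> ring_center R \<Longrightarrow> c \<otimes> c = \<zero> \<Longrightarrow> c = \<zero>"
  shows "cring R"
proof -
  note E = ce[unfolded centrally_essential_iff[OF ring_axioms], rule_format]
  have "a \<otimes> b = b \<otimes> a" if a: "a \<in> carrier R" and b: "b \<in> carrier R" for a b
  proof (rule ccontr)
    let ?d = "a \<otimes> b \<ominus> b \<otimes> a"
    assume ne: "a \<otimes> b \<noteq> b \<otimes> a"
    have d: "?d \<in> carrier R" "?d \<noteq> \<zero>"
      using a b ne by auto
    obtain c where c: "c \<in> ring_center R" "?d \<otimes> c \<noteq> \<zero>" "?d \<otimes> c \<in> ring_center R"
      using E[OF d] by blast
    let ?z = "?d \<otimes> c"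
    have cR: "c \<in> carrier R" using c center_closed by blast
    have zR: "?z \<in> carrier R" using d cR by simp
    obtain e where e: "e \<in> ring_center R" "?z \<otimes> e \<noteq> \<zero>" "?z \<otimes> e \<in> central_denominators a"
      using central_denominators_essential[OF ce a zR c(2)] by blast
    let ?w = "?z \<otimes> e"
    have eR: "e \<in> carrier R" using e center_closed by blast
    have wC: "?w \<in> ring_center R" using e(3) by (simp add: central_denominators_def)
    have wR: "?w \<in> carrier R" using wC center_closed by blast
    have "?d \<otimes> ?w = \<zero>" by (rule commutator_central_denominator[OF a b e(3)])
    then have "?d \<otimes> ?w \<otimes> (c \<otimes> e) = \<zero>" using cR eR by simp
    moreover have "?d \<otimes> ?w \<otimes> (c \<otimes> e) = ?d \<otimes> (c \<otimes> e) \<otimes> ?w"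
      using d(1) cR eR wR center_commute[OF wC, of "c \<otimes> e"] by (simp add: m_assoc)
    ultimately have "?w \<otimes> ?w = \<zero>"
      using d(1) cR eR by (simp add: m_assoc)
    then show False using red[OF wC] e(2) by blast
  qed
  then show ?thesis
    by (intro cring.intro ring_axioms comm_monoid.intro monoid_axioms comm_monoid_axioms.intro)
qed

text \<open>
  If \<open>c\<close> is central with \<open>c\<^sup>2 = 0\<close>, every right ideal containing \<open>h\<close> also contains \<open>c h = h c\<close>, and
  one of \<open>h\<close> and \<open>c h\<close> is a nonzero element annihilated by \<open>c\<close> if \<open>h\<close> is nonzero.  So the
  annihilator of \<open>c\<close> is essential.
\<close>

lemma center_reduced_if_right_nonsingular:
  assumes ns: "right_nonsingular R" and c: "c \<in> ring_center R" "c \<otimes> c = \<zero>"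
  shows "c = \<zero>"
proof -
  have cR: "c \<in> carrier R" using c center_closed by blast
  have zero: "\<zero>\<^bsub>right_regular R\<^esub> = \<zero>" by (simp add: right_regular_def)
  have "essential_submodule (right_annihilator R c) R (right_regular R)"
    unfolding essential_submodule_def zero
  proof (intro conjI allI impI)
    show "right_ideal R (right_annihilator R c)"
      using cR by (intro right_idealI) (auto simp: right_annihilator_def r_distr simp flip: m_assoc)
    fix H assume H: "right_ideal R H \<and> H \<noteq> {\<zero>}"
    then obtain h where h: "h \<in> H" "h \<noteq> \<zero>" using right_ideal_zero by blast
    then have hR: "h \<in> carrier R" using H right_ideal_subset by blast
    show "right_annihilator R c \<inter> H \<noteq> {\<zero>}"
    proof (cases "c \<otimes> h = \<zero>")
      case True
      then show ?thesis using h hR by (auto simp: right_annihilator_def)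
    next
      case False
      have "c \<otimes> h \<in> H"
        using H h right_ideal_mult cR center_commute[OF c(1) hR] by simp
      moreover have "c \<otimes> (c \<otimes> h) = \<zero>"
        using c(2) cR hR by (simp flip: m_assoc)
      ultimately show ?thesis using False cR hR by (auto simp: right_annihilator_def)
    qed
  qed
  then show ?thesis using ns cR by (auto simp: right_nonsingular_def)
qed

lemma one_center: "\<one> \<in> ring_center R"
  by (simp add: ring_center_def)

lemma center_ring_is_ring: "ring (center_ring R)"
proof -
  let ?C = "center_ring R"
  interpret C: additive_subgroup "ring_center R" R
    by (rule ring_center_additive_subgroup[OF ring_axioms])
  note one = one_center and simps = center_ring_simps[of R]
  show ?thesis
  proof (rule ringI)
    show "abelian_group ?C"
    proof (rule abelian_groupI, unfold simps)
      fix x assume "x \<in> ring_center R"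
      then show "\<exists>y\<in>ring_center R. y \<oplus> x = \<zero>"
        by (intro bexI[of _ "\<ominus> x"]) (auto simp: center_closed l_neg)
    qed (auto simp: center_closed a_ac)
    show "monoid ?C"
      by (rule monoidI, unfold simps)
         (auto simp: center_closed one m_assoc ring_center_mult[OF ring_axioms])
  qed (auto simp: simps center_closed l_distr r_distr)
qed

text \<open>
  If \<open>c\<^sup>2 = 0\<close>, then \<open>c C\<close> is an ideal of the commutative ring \<open>C\<close> with square zero.
\<close>

lemma center_reduced_if_semiprime:
  assumes sp: "semiprime_ring (center_ring R)" and c: "c \<in> ring_center R" "c \<otimes> c = \<zero>"
  shows "c = \<zero>"
proof -
  let ?C = "center_ring R"
  interpret C: additive_subgroup "ring_center R" R
    by (rule ring_center_additive_subgroup[OF ring_axioms])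
  have cR: "c \<in> carrier R" using c center_closed by blast
  note one = one_center and simps = center_ring_simps[of R]
  have ringC: "ring ?C" by (rule center_ring_is_ring)
  let ?I = "(\<lambda>x. c \<otimes> x) ` ring_center R"
  have I: "ideal ?I ?C"
  proof (rule idealI[OF ringC])
    have C': "group (add_monoid ?C)"
      by (rule abelian_group.a_group[OF ring.is_abelian_group[OF ringC]])
    show "subgroup ?I (add_monoid ?C)"
    proof (rule group.subgroupI[OF C'])
      show "?I \<subseteq> carrier (add_monoid ?C)"
        using ring_center_mult[OF ring_axioms c(1)] by (auto simp: simps)
      show "?I \<noteq> {}" using one by blast
      show "inv\<^bsub>add_monoid ?C\<^esub> x \<in> ?I" if x: "x \<in> ?I" for x
      proof -
        obtain y where y: "y \<in> ring_center R" "x = c \<otimes> y" using x by blast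
        have my: "c \<otimes> (\<ominus> y) \<in> ring_center R" "\<ominus> y \<in> ring_center R"
          using y ring_center_mult[OF ring_axioms c(1)] by auto
        have "c \<otimes> (\<ominus> y) \<oplus> x = \<zero>"
          using y cR center_closed by (simp add: r_minus l_neg)
        then have "inv\<^bsub>add_monoid ?C\<^esub> x = c \<otimes> (\<ominus> y)"
          using my y c ring_center_mult[OF ring_axioms]
          by (intro group.inv_equality[OF C']) (auto simp: simps)
        then show ?thesis using my by auto
      qed
      show "x \<otimes>\<^bsub>add_monoid ?C\<^esub> y \<in> ?I" if xy: "x \<in> ?I" "y \<in> ?I" for x y
      proof -
        obtain u v where "u \<in> ring_center R" "x = c \<otimes> u" "v \<in> ring_center R" "y = c \<otimes> v"
          using xy by blast
        then have "x \<oplus> y = c \<otimes> (u \<oplus> v)" "u \<oplus> v \<in> ring_center R"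
          using cR center_closed by (auto simp: r_distr)
        then show ?thesis by (auto simp: simps)
      qed
    qed
  next
    fix x y assume "x \<in> ?I" "y \<in> carrier ?C"
    then obtain u where u: "u \<in> ring_center R" "x = c \<otimes> u" "y \<in> ring_center R"
      by (auto simp: simps)
    then have "c \<otimes> u \<otimes> y = c \<otimes> (u \<otimes> y)" "y \<otimes> (c \<otimes> u) = c \<otimes> u \<otimes> y"
      using cR center_closed by (simp add: m_assoc, intro center_commute) auto
    moreover have "u \<otimes> y \<in> ring_center R" using u ring_center_mult[OF ring_axioms] by blast
    ultimately show "y \<otimes>\<^bsub>?C\<^esub> x \<in> ?I" "x \<otimes>\<^bsub>?C\<^esub> y \<in> ?I"
      using u by (auto simp: simps)
  qed
  interpret CR: ring ?C by (rule ringC)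
  interpret I: ideal ?I ?C by (rule I)
  have "x = \<zero>" if "x \<in> ideal_prod ?C ?I ?I" for x
    using that
  proof (induction rule: ideal_prod.induct)
    case (prod i j)
    then obtain u v where "u \<in> ring_center R" "i = c \<otimes> u" "v \<in> ring_center R" "j = c \<otimes> v"
      by blast
    then have uv: "u \<in> carrier R" "v \<in> carrier R" "i = c \<otimes> u" "j = c \<otimes> v"
      using center_closed by auto
    have "i \<otimes> j = c \<otimes> (u \<otimes> c) \<otimes> v"
      using uv cR by (simp add: m_assoc)
    also have "\<dots> = c \<otimes> c \<otimes> (u \<otimes> v)"
      using uv cR by (simp add: m_assoc flip: center_commute[OF c(1), of u])
    finally show ?case using c(2) uv by (simp add: simps)
  next
    case (sum s1 s2)
    then show ?case by (simp add: simps)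
  qed
  moreover have "\<zero> \<in> ideal_prod ?C ?I ?I"
    using ideal_prod.prod[where R = ?C, OF I.zero_closed I.zero_closed] by (simp add: simps)
  ultimately have "ideal_prod ?C ?I ?I = {\<zero>}" by blast
  then have "ideal_power ?C ?I (Suc (Suc 0)) = {\<zero>\<^bsub>?C\<^esub>}"
    using CR.ideal_prod_one[OF I] by (simp add: simps)
  then have "?I = {\<zero>}"
    using sp I unfolding semiprime_ring_def by (metis simps(4))
  moreover have "c \<in> ?I" using one cR by (auto intro!: image_eqI[of _ _ \<one>])
  ultimately show ?thesis by blast
qed

end


section \<open>Simple covers of right ideals\<close>

text \<open>
  The consequence of the semi-Artinian condition on which the proof rests, stated with right ideals
  of \<open>R\<close> instead of submodules of factor modules.
\<close>

definition has_simple_covers :: "('a, 'm) ring_scheme \<Rightarrow> bool" where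
  "has_simple_covers R \<longleftrightarrow> (\<forall>N. right_ideal R N \<and> N \<noteq> carrier R \<longrightarrow>
     (\<exists>T. right_ideal R T \<and> N \<subset> T \<and>
       (\<forall>H. right_ideal R H \<and> N \<subseteq> H \<and> H \<subseteq> T \<longrightarrow> H = N \<or> H = T)))"

context ring
begin

lemma right_ideal_eq_carrier:
  assumes "right_ideal R I" "\<one> \<in> I"
  shows "I = carrier R"
  using right_ideal_subset[OF assms(1)] right_ideal_mult[OF assms] by auto

lemma right_ideal_carrier: "right_ideal R (carrier R)"
  by (rule right_idealI) auto

lemma right_ideal_sum:
  assumes N: "right_ideal R N" and H: "right_ideal R H" and f: "f \<in> carrier R"
  shows "right_ideal R {n \<oplus> f \<otimes> k | n k. n \<in> N \<and> k \<in> H}" (is "right_ideal R ?S")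
proof (rule right_idealI)
  note NH = right_ideal_subset[OF N, THEN subsetD] right_ideal_subset[OF H, THEN subsetD]
  show "?S \<subseteq> carrier R" using NH f by auto
  have "\<zero> = \<zero> \<oplus> f \<otimes> \<zero>" using f by simp
  then show "\<zero> \<in> ?S" using right_ideal_zero[OF N] right_ideal_zero[OF H] by blast
  fix x assume "x \<in> ?S"
  then obtain n k where x: "x = n \<oplus> f \<otimes> k" "n \<in> N" "k \<in> H" by blast
  show "x \<oplus> y \<in> ?S" if y: "y \<in> ?S" for y
  proof -
    obtain n' k' where y: "y = n' \<oplus> f \<otimes> k'" "n' \<in> N" "k' \<in> H" using y by blast
    have "x \<oplus> y = (n \<oplus> n') \<oplus> f \<otimes> (k \<oplus> k')"
      using x y NH f by (simp add: r_distr a_ac)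
    then show ?thesis using x y right_ideal_add[OF N] right_ideal_add[OF H] by blast
  qed
  show "x \<otimes> r \<in> ?S" if r: "r \<in> carrier R" for r
  proof -
    have "x \<otimes> r = n \<otimes> r \<oplus> f \<otimes> (k \<otimes> r)"
      using x NH f r by (simp add: l_distr m_assoc)
    then show ?thesis using x r right_ideal_mult[OF N] right_ideal_mult[OF H] by blast
  qed
qed

lemma right_ideal_quotient:
  assumes N: "right_ideal R N" and f: "f \<in> carrier R"
  shows "right_ideal R {r \<in> carrier R. f \<otimes> r \<in> N}"
  using right_idealD[OF N] f
  by (intro right_idealI) (auto simp: r_distr simp flip: m_assoc)

text \<open>
  The \<open>r\<close> with \<open>f r \<in> N\<close> form the annihilator of a nonzero element of the simple module \<open>T / N\<close>; if
  \<open>H\<close> contains it properly, then \<open>N + f H\<close> is all of \<open>T\<close>, hence contains \<open>f\<close>, and so \<open>1 \<in> H\<close>.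
\<close>

lemma maximal_annihilator_of_simple:
  assumes N: "right_ideal R N" and T: "right_ideal R T" and NT: "N \<subseteq> T"
    and min: "\<And>H. right_ideal R H \<Longrightarrow> N \<subseteq> H \<Longrightarrow> H \<subseteq> T \<Longrightarrow> H = N \<or> H = T"
    and f: "f \<in> T" "f \<notin> N"
  shows "maximal_right_ideal {r \<in> carrier R. f \<otimes> r \<in> N} R" (is "maximal_right_ideal ?P R")
proof -
  have fR: "f \<in> carrier R" using f right_ideal_subset[OF T] by blast
  have "\<one> \<notin> ?P" using f fR by simp
  moreover have "H = carrier R" if H: "right_ideal R H" and PH: "?P \<subseteq> H" and ne: "H \<noteq> ?P" for H
  proof -
    obtain h where h: "h \<in> H" "f \<otimes> h \<notin> N"
      using PH ne right_ideal_subset[OF H] by blast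
    let ?K = "{n \<oplus> f \<otimes> k | n k. n \<in> N \<and> k \<in> H}"
    note sub = right_ideal_subset[OF H, THEN subsetD] right_ideal_subset[OF N, THEN subsetD]
    have K: "right_ideal R ?K" by (rule right_ideal_sum[OF N H fR])
    have "n \<in> ?K" if "n \<in> N" for n
    proof -
      have "n = n \<oplus> f \<otimes> \<zero>" using that fR sub by simp
      then show ?thesis using that right_ideal_zero[OF H] by blast
    qed
    moreover have "f \<otimes> h \<in> ?K"
    proof -
      have "f \<otimes> h = \<zero> \<oplus> f \<otimes> h" using h fR sub by simp
      then show ?thesis using h right_ideal_zero[OF N] by blast
    qed
    moreover have "?K \<subseteq> T"
      using NT right_ideal_add[OF T] right_ideal_mult[OF T f(1)] sub by blast
    ultimately have "?K = T" using min[OF K] h by blast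
    then obtain n k where nk: "f = n \<oplus> f \<otimes> k" "n \<in> N" "k \<in> H" using f by blast
    then have kR: "k \<in> carrier R" "n \<in> carrier R" using sub by auto
    have "f \<otimes> (\<one> \<ominus> k) = f \<ominus> f \<otimes> k"
      using fR kR by (simp add: a_minus_def r_distr r_minus)
    also have "\<dots> = n"
      using nk(1) fR kR
      by (metis a_minus_def a_assoc add.inv_closed m_closed r_neg r_zero)
    finally have "\<one> \<ominus> k \<in> H" using nk kR PH by auto
    then have "(\<one> \<ominus> k) \<oplus> k \<in> H" using right_ideal_add[OF H] nk by blast
    then have "\<one> \<in> H" using kR by (simp add: a_minus_def a_assoc l_neg)
    then show ?thesis using right_ideal_eq_carrier[OF H] by blast
  qed
  ultimately show ?thesis
    using right_ideal_quotient[OF N fR] unfolding maximal_right_ideal_def by blast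
qed

lemma maximal_right_ideal_comaximal:
  assumes M: "maximal_right_ideal M R" and a: "a \<in> carrier R" "a \<notin> M"
  shows "\<exists>y\<in>carrier R. \<one> \<ominus> a \<otimes> y \<in> M"
proof -
  have N: "right_ideal R M" using M by (simp add: maximal_right_ideal_def)
  note sub = right_ideal_subset[OF N, THEN subsetD]
  let ?K = "{n \<oplus> a \<otimes> k | n k. n \<in> M \<and> k \<in> carrier R}"
  have K: "right_ideal R ?K" by (rule right_ideal_sum[OF N right_ideal_carrier a(1)])
  have MK: "M \<subseteq> ?K"
  proof
    fix n assume n: "n \<in> M"
    then have "n = n \<oplus> a \<otimes> \<zero>" using a sub by simp
    then show "n \<in> ?K" using n by blast
  qed
  have "a \<in> ?K"
  proof -
    have "a = \<zero> \<oplus> a \<otimes> \<one>" using a by simp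
    then show ?thesis using right_ideal_zero[OF N] by blast
  qed
  then have "?K \<noteq> M" using a(2) by (metis (no_types, lifting))
  have "\<forall>H. right_ideal R H \<and> M \<subseteq> H \<longrightarrow> H = M \<or> H = carrier R"
    using M by (simp add: maximal_right_ideal_def)
  from this[THEN spec, THEN mp, OF conjI[OF K MK]] \<open>?K \<noteq> M\<close>
  have "?K = carrier R" by iprover
  then have "\<one> \<in> ?K" by (simp only: one_closed)
  then obtain n k where nk: "\<one> = n \<oplus> a \<otimes> k" "n \<in> M" "k \<in> carrier R"
    by blast
  then have "\<one> \<ominus> a \<otimes> k = n"
    using a sub by (metis a_minus_def a_assoc add.inv_closed m_closed r_neg r_zero)
  then show ?thesis using nk by blast
qed

lemma right_ideal_maximal_avoiding:
  assumes N0: "right_ideal R N0" and F: "F \<inter> N0 = {}"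
  obtains N where "right_ideal R N" "N0 \<subseteq> N" "F \<inter> N = {}"
    "\<forall>H. right_ideal R H \<and> N \<subseteq> H \<and> F \<inter> H = {} \<longrightarrow> H = N"
proof -
  let ?A = "{N. right_ideal R N \<and> N0 \<subseteq> N \<and> F \<inter> N = {}}"
  have "\<exists>N\<in>?A. \<forall>H\<in>?A. N \<subseteq> H \<longrightarrow> H = N"
  proof (rule subset_Zorn_nonempty)
    show "?A \<noteq> {}" using N0 F by blast
    fix \<C> assume ne: "\<C> \<noteq> {}" and ch: "subset.chain ?A \<C>"
    have mem: "right_ideal R N" "N0 \<subseteq> N" "F \<inter> N = {}" if "N \<in> \<C>" for N
      using that ch by (auto simp: subset.chain_def)
    have "right_ideal R (\<Union>\<C>)"
    proof (rule right_idealI)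
      show "\<Union>\<C> \<subseteq> carrier R" using mem(1) right_ideal_subset by blast
      show "\<zero> \<in> \<Union>\<C>" using ne mem(1) right_ideal_zero by blast
      show "x \<oplus> y \<in> \<Union>\<C>" if xy: "x \<in> \<Union>\<C>" "y \<in> \<Union>\<C>" for x y
      proof -
        obtain X Y where XY: "x \<in> X" "X \<in> \<C>" "y \<in> Y" "Y \<in> \<C>" using xy by blast
        then have "X \<subseteq> Y \<or> Y \<subseteq> X" using ch XY(2,4) unfolding subset_chain_def by blast
        then obtain Z where "Z \<in> \<C>" "x \<in> Z" "y \<in> Z" using XY by blast
        then show ?thesis using mem(1) right_ideal_add by blast
      qed
      show "x \<otimes> r \<in> \<Union>\<C>" if "x \<in> \<Union>\<C>" "r \<in> carrier R" for x r
        using that mem(1) right_ideal_mult by blast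
    qed
    then show "\<Union>\<C> \<in> ?A" using ne mem(2,3) by blast
  qed
  then obtain N where N: "N \<in> ?A" and max: "\<forall>H\<in>?A. N \<subseteq> H \<longrightarrow> H = N" ..
  show ?thesis
  proof (rule that[of N])
    show "\<forall>H. right_ideal R H \<and> N \<subseteq> H \<and> F \<inter> H = {} \<longrightarrow> H = N"
      using max N by auto
  qed (use N in auto)
qed

lemma exists_maximal_right_ideal:
  assumes N0: "right_ideal R N0" and one: "\<one> \<notin> N0"
  shows "\<exists>M. maximal_right_ideal M R \<and> N0 \<subseteq> M"
proof -
  have "{\<one>} \<inter> N0 = {}" using one by simp
  from right_ideal_maximal_avoiding[OF N0 this]
  obtain M where M: "right_ideal R M" "N0 \<subseteq> M" "{\<one>} \<inter> M = {}"
    and max: "\<forall>H. right_ideal R H \<and> M \<subseteq> H \<and> {\<one>} \<inter> H = {} \<longrightarrow> H = M" .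
  have "M \<noteq> carrier R" using M(3) by auto
  moreover have "H = M \<or> H = carrier R" if "right_ideal R H" "M \<subseteq> H" for H
    using max that right_ideal_eq_carrier[OF that(1)] by auto
  ultimately have "maximal_right_ideal M R"
    using M(1) by (simp add: maximal_right_ideal_def)
  then show ?thesis using M by blast
qed

text \<open>
  Take \<open>N\<close> maximal among the right ideals above \<open>N0\<close> that avoid \<open>F\<close>, and \<open>T\<close> with \<open>T / N\<close> simple.
  By maximality \<open>T\<close> meets \<open>F\<close> in some \<open>f\<close>.
\<close>

proposition simple_cover_principle:
  assumes cov: "has_simple_covers R" and N0: "right_ideal R N0"
    and F: "F \<subseteq> carrier R" "F \<noteq> {}" "F \<inter> N0 = {}"
  shows "\<exists>N f. right_ideal R N \<and> N0 \<subseteq> N \<and> F \<inter> N = {} \<and> f \<in> F \<and>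
    maximal_right_ideal {r \<in> carrier R. f \<otimes> r \<in> N} R"
proof -
  obtain N where N: "right_ideal R N" "N0 \<subseteq> N" "F \<inter> N = {}"
    and max: "\<forall>H. right_ideal R H \<and> N \<subseteq> H \<and> F \<inter> H = {} \<longrightarrow> H = N"
    by (rule right_ideal_maximal_avoiding[OF N0 F(3)])
  have "N \<noteq> carrier R" using F N by blast
  with N(1) have "right_ideal R N \<and> N \<noteq> carrier R" ..
  from cov[unfolded has_simple_covers_def, THEN spec, THEN mp, OF this]
  obtain T where T: "right_ideal R T" "N \<subset> T"
    and min: "\<forall>H. right_ideal R H \<and> N \<subseteq> H \<and> H \<subseteq> T \<longrightarrow> H = N \<or> H = T"
    by (elim exE conjE)
  have "F \<inter> T \<noteq> {}" using max T by auto
  then obtain f where f: "f \<in> F" "f \<in> T" "f \<notin> N" using N by blast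
  have "maximal_right_ideal {r \<in> carrier R. f \<otimes> r \<in> N} R"
    using min T(2) by (intro maximal_annihilator_of_simple[OF N(1) T(1) _ _ f(2,3)]) auto
  then show ?thesis using N f by blast
qed

end


section \<open>The Jacobson radical\<close>

context ring
begin

lemma jacobson_radical_mem_maximal:
  "x \<in> jacobson_radical R \<Longrightarrow> maximal_right_ideal M R \<Longrightarrow> x \<in> M"
  by (simp add: jacobson_radical_def)

text \<open>
  For closure under left multiplication by \<open>r\<close>: if \<open>M\<close> is a maximal right ideal not containing \<open>r\<close>,
  the \<open>s\<close> with \<open>r s \<in> M\<close> form a maximal right ideal too.
\<close>

lemma jacobson_radical_ideal: "ideal (jacobson_radical R) R"
proof -
  let ?J = "jacobson_radical R"
  have J: "right_ideal R ?J"
  proof (rule right_idealI)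
    have "right_ideal R M" if "maximal_right_ideal M R" for M
      using that by (simp add: maximal_right_ideal_def)
    note M = right_idealD[OF this]
    show "?J \<subseteq> carrier R" "\<zero> \<in> ?J" using M by (auto simp: jacobson_radical_def)
    show "x \<oplus> y \<in> ?J" if "x \<in> ?J" "y \<in> ?J" for x y
      using that M(3) by (auto simp: jacobson_radical_def)
    show "x \<otimes> r \<in> ?J" if "x \<in> ?J" "r \<in> carrier R" for x r
      using that M(4) by (auto simp: jacobson_radical_def)
  qed
  have left: "r \<otimes> x \<in> ?J" if x: "x \<in> ?J" and r: "r \<in> carrier R" for x r
  proof -
    have xR: "x \<in> carrier R" using x by (simp add: jacobson_radical_def)
    have "r \<otimes> x \<in> M" if M: "maximal_right_ideal M R" for M
    proof (cases "r \<in> M")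
      case True
      then show ?thesis
        using M xR right_ideal_mult unfolding maximal_right_ideal_def by blast
    next
      case False
      have "maximal_right_ideal {s \<in> carrier R. r \<otimes> s \<in> M} R"
        using M r False right_ideal_carrier right_ideal_subset
        by (intro maximal_annihilator_of_simple[of M "carrier R"])
           (auto simp: maximal_right_ideal_def)
      then show ?thesis using jacobson_radical_mem_maximal[OF x] by blast
    qed
    then show ?thesis using xR r by (simp add: jacobson_radical_def)
  qed
  have "additive_subgroup ?J R"
    using J submodule_right_regular_iff[OF ring_axioms, of R] by simp
  then show ?thesis
    using left right_ideal_mult[OF J] by (intro ideal.intro ideal_axioms.intro ring_axioms)
qed

lemma ideal_is_right_ideal: "ideal I R \<Longrightarrow> right_ideal R I"
  by (simp add: submodule_right_regular_iff[OF ring_axioms] ideal.axioms ideal.I_r_closed)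

text \<open>
  The geometric series; \<open>q\<close> is \<open>1 + y + \<dots> + y\<^sup>n\<^sup>-\<^sup>1\<close>.
\<close>

lemma one_minus_pow:
  assumes y: "y \<in> carrier R"
  shows "\<exists>q\<in>carrier R. \<one> \<ominus> y [^] (n::nat) = (\<one> \<ominus> y) \<otimes> q \<and> (\<one> \<ominus> y) \<otimes> q = q \<otimes> (\<one> \<ominus> y)"
proof (induction n)
  case 0
  then show ?case using y by (intro bexI[of _ \<zero>]) (auto simp: a_minus_def r_neg)
next
  case (Suc n)
  then obtain q where q: "q \<in> carrier R" "\<one> \<ominus> y [^] n = (\<one> \<ominus> y) \<otimes> q"
    "(\<one> \<ominus> y) \<otimes> q = q \<otimes> (\<one> \<ominus> y)" by blast
  let ?p = "y [^] n"
  have yp: "?p \<in> carrier R" "y [^] Suc n = y \<otimes> ?p"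
    using y by (simp, rule nat_pow_Suc2)
  have c: "y \<otimes> (\<one> \<ominus> y) = (\<one> \<ominus> y) \<otimes> y"
    using y by (simp add: a_minus_def l_distr r_distr l_minus r_minus)
  have "\<one> \<ominus> y \<otimes> ?p = (\<one> \<ominus> y) \<oplus> y \<otimes> (\<one> \<ominus> ?p)"
    using y yp(1) by (simp add: a_minus_def r_distr r_minus a_assoc r_neg1)
  also have "\<dots> = (\<one> \<ominus> y) \<otimes> (\<one> \<oplus> y \<otimes> q)"
    using y q(1) c unfolding q(2) by (simp add: r_distr) (metis m_assoc minus_closed one_closed)
  finally have 1: "\<one> \<ominus> y [^] Suc n = (\<one> \<ominus> y) \<otimes> (\<one> \<oplus> y \<otimes> q)" using yp(2) by simp
  have "(\<one> \<oplus> y \<otimes> q) \<otimes> (\<one> \<ominus> y) = (\<one> \<ominus> y) \<oplus> y \<otimes> (q \<otimes> (\<one> \<ominus> y))"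
    using y q(1) by (simp add: l_distr m_assoc)
  also have "\<dots> = (\<one> \<ominus> y) \<oplus> y \<otimes> ((\<one> \<ominus> y) \<otimes> q)" using q(3) by simp
  also have "\<dots> = (\<one> \<ominus> y) \<otimes> (\<one> \<oplus> y \<otimes> q)"
    using y q(1) c by (simp add: r_distr) (metis m_assoc minus_closed one_closed)
  finally show ?case using 1 y q(1) by (intro bexI[of _ "\<one> \<oplus> y \<otimes> q"]) auto
qed

lemma one_minus_nilpotent:
  assumes y: "y \<in> carrier R" "y [^] (n::nat) = \<zero>"
  shows "\<exists>q\<in>carrier R. (\<one> \<ominus> y) \<otimes> q = \<one>"
  using one_minus_pow[OF y(1), of n] y(2) by (auto simp: a_minus_def)

text \<open>
  A maximal right ideal \<open>M\<close> without \<open>x\<close> would contain some \<open>1 - x r\<close>, which is invertible because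
  \<open>x r\<close> is nilpotent.
\<close>

lemma mem_jacobson_radical_if_nil:
  assumes x: "x \<in> carrier R" and nil: "\<And>r. r \<in> carrier R \<Longrightarrow> \<exists>n::nat. (x \<otimes> r) [^] n = \<zero>"
  shows "x \<in> jacobson_radical R"
proof (rule ccontr)
  assume "x \<notin> jacobson_radical R"
  then obtain M where M: "maximal_right_ideal M R" "x \<notin> M"
    using x by (auto simp: jacobson_radical_def)
  obtain r where r: "r \<in> carrier R" "\<one> \<ominus> x \<otimes> r \<in> M"
    using maximal_right_ideal_comaximal[OF M(1) x M(2)] by blast
  obtain q where q: "q \<in> carrier R" "(\<one> \<ominus> x \<otimes> r) \<otimes> q = \<one>"
    using nil[OF r(1)] one_minus_nilpotent[of "x \<otimes> r"] x r(1) by blast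
  have "right_ideal R M" "M \<noteq> carrier R" using M by (auto simp: maximal_right_ideal_def)
  then show False
    using right_ideal_mult[of M, OF _ r(2) q(1)] q(2) right_ideal_eq_carrier by metis
qed

text \<open>
  If no power of \<open>x\<close> were zero, let \<open>N\<close> avoid all of them, and let \<open>f = x\<^sup>n\<close> be such that the \<open>r\<close> with \<open>f r \<in> N\<close> form a
  maximal right ideal.  This ideal contains \<open>x\<close>, so that \<open>x\<^sup>n\<^sup>+\<^sup>1 \<in> N\<close>, a contradiction.
\<close>

proposition jacobson_radical_nil:
  assumes cov: "has_simple_covers R" and x: "x \<in> jacobson_radical R"
  shows "\<exists>n::nat. x [^] n = \<zero>"
proof (rule ccontr)
  assume nn: "\<nexists>n::nat. x [^] n = \<zero>"
  let ?F = "range (\<lambda>n::nat. x [^] n)"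
  have xR: "x \<in> carrier R" using x by (simp add: jacobson_radical_def)
  have zero: "right_ideal R {\<zero>}" by (rule right_idealI) auto
  have "?F \<subseteq> carrier R" "?F \<noteq> {}" "?F \<inter> {\<zero>} = {}" using xR nn by force+
  from simple_cover_principle[OF cov zero this]
  obtain N f where N: "?F \<inter> N = {}" and f: "f \<in> ?F"
    and max: "maximal_right_ideal {r \<in> carrier R. f \<otimes> r \<in> N} R" by blast
  obtain n :: nat where n: "f = x [^] n" using f by blast
  have "f \<otimes> x \<in> N" using jacobson_radical_mem_maximal[OF x max] by simp
  then have "x [^] Suc n \<in> N" using n by simp
  then show False using N by blast
qed

end


section \<open>The quotient by the Jacobson radical\<close>

text \<open>
  The quotient is described by elements of \<open>R\<close>, and nothing here depends on the side on which
  ideals act.  So the notion agrees for \<open>R\<close> and its opposite ring, whereas the Jacobson radical is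
  defined by right ideals.
\<close>

definition nil_with_commutative_regular_quotient :: "'a set \<Rightarrow> ('a, 'm) ring_scheme \<Rightarrow> bool" where
  "nil_with_commutative_regular_quotient N R \<longleftrightarrow> ideal N R \<and>
     (\<forall>x\<in>N. \<exists>n::nat. x [^]\<^bsub>R\<^esub> n = \<zero>\<^bsub>R\<^esub>) \<and>
     (\<forall>a\<in>carrier R. \<forall>b\<in>carrier R. a \<otimes>\<^bsub>R\<^esub> b \<ominus>\<^bsub>R\<^esub> b \<otimes>\<^bsub>R\<^esub> a \<in> N) \<and>
     (\<forall>a\<in>carrier R. \<exists>x\<in>carrier R. a \<ominus>\<^bsub>R\<^esub> a \<otimes>\<^bsub>R\<^esub> x \<otimes>\<^bsub>R\<^esub> a \<in> N)"

lemma (in ideal) coset_eq_iff: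
  assumes "x \<in> carrier R" "y \<in> carrier R"
  shows "I +> x = I +> y \<longleftrightarrow> x \<ominus> y \<in> I"
  using assms a_rcos_module_minus[OF ring_axioms, of y x] a_rcos_self a_repr_independence'
  by metis

lemma (in ideal) quotient_carrier: "carrier (R Quot I) = (\<lambda>x. I +> x) ` carrier R"
  by (auto simp: FactRing_def A_RCOSETS_def')

lemma (in ideal) quotient_commutative:
  assumes comm: "\<And>a b. a \<in> carrier R \<Longrightarrow> b \<in> carrier R \<Longrightarrow> a \<otimes> b \<ominus> b \<otimes> a \<in> I"
  shows "cring (R Quot I)"
proof -
  interpret Q: ring "R Quot I" by (rule quotient_is_ring)
  have "x \<otimes>\<^bsub>R Quot I\<^esub> y = y \<otimes>\<^bsub>R Quot I\<^esub> x"
    if xy: "x \<in> carrier (R Quot I)" "y \<in> carrier (R Quot I)" for x y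
  proof -
    obtain a b where "x = I +> a" "y = I +> b" "a \<in> carrier R" "b \<in> carrier R"
      using xy unfolding quotient_carrier by blast
    then show ?thesis
      using comm[of a b] by (simp add: FactRing_def rcoset_mult_add coset_eq_iff)
  qed
  then show ?thesis
    by (intro cring.intro Q.ring_axioms comm_monoid.intro Q.monoid_axioms comm_monoid_axioms.intro)
qed

text \<open>
  The power is a multiple of \<open>a\<^sup>n e\<close>.  This is applied in \<open>R / J(R)\<close> with \<open>e = 1 - a x\<close>.
\<close>

lemma (in cring) nilpotent_mult_if_power_mult_zero:
  assumes "a \<in> carrier R" "e \<in> carrier R" "r \<in> carrier R" and zero: "a [^] (n::nat) \<otimes> e = \<zero>"
  shows "(e \<otimes> a \<otimes> r) [^] Suc n = \<zero>"
proof -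
  have "(e \<otimes> a \<otimes> r) [^] Suc n = (a [^] n \<otimes> e) \<otimes> (e [^] n \<otimes> r [^] n \<otimes> a \<otimes> r)"
    using assms(1-3) by (simp add: nat_pow_distrib m_ac)
  then show ?thesis using zero assms(1-3) by simp
qed

context ring
begin

text \<open>
  For an idempotent \<open>v\<close> the reason is that a nonzero \<open>z = v c \<in> L\<^sub>a\<close> would satisfy \<open>z = v z = 0\<close>.  In
  general put \<open>w = 1 - v\<close>.  Then \<open>w\<^sup>m v\<^sup>m = 0\<close> while \<open>1 - w\<^sup>m = q v\<close>, so \<open>v\<^sup>m = q v v\<^sup>m\<close>, and a nonzero
  \<open>z = v\<^sup>m c \<in> L\<^sub>a\<close> satisfies \<open>z = q v z = 0\<close>.
\<close>

lemma nilpotent_if_idempotent_mod_nil: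
  assumes ce: "centrally_essential R" and a: "a \<in> carrier R" and v: "v \<in> carrier R"
    and ann: "\<And>z. z \<in> central_denominators a \<Longrightarrow> v \<otimes> z = \<zero>"
    and nil: "(v \<ominus> v \<otimes> v) [^] (m::nat) = \<zero>"
  shows "v [^] m = \<zero>"
proof (rule ccontr)
  assume vm: "v [^] m \<noteq> \<zero>"
  define w where "w = \<one> \<ominus> v"
  have w: "w \<in> carrier R" using v by (simp add: w_def)
  have wv: "\<one> \<ominus> w = v"
    using v by (simp add: w_def a_minus_def minus_add a_assoc[symmetric] r_neg)
  have "w \<otimes> v = v \<otimes> w" "w \<otimes> v = v \<ominus> v \<otimes> v"
    using v by (simp_all add: w_def a_minus_def l_distr r_distr l_minus r_minus)
  then have wvm: "w [^] m \<otimes> v [^] m = \<zero>"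
    using nil pow_mult_distrib[of w v m] v w by simp
  obtain q where q: "q \<in> carrier R" "\<one> \<ominus> w [^] m = q \<otimes> v"
    using one_minus_pow[OF w, of m] unfolding wv by auto
  have "q \<otimes> v \<otimes> v [^] m = v [^] m"
    unfolding q(2)[symmetric] using v w wvm by (simp add: a_minus_def l_distr l_minus)
  moreover obtain c where c: "c \<in> ring_center R" "v [^] m \<otimes> c \<noteq> \<zero>"
    "v [^] m \<otimes> c \<in> central_denominators a"
    using central_denominators_essential[OF ce a _ vm] v by auto
  ultimately have "v [^] m \<otimes> c = q \<otimes> (v \<otimes> (v [^] m \<otimes> c))"
    using v q(1) center_closed[OF c(1)] by (metis m_assoc m_closed nat_pow_closed)
  then show False using ann[OF c(3)] c(2) q(1) by simp
qed

text \<open>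
  Suppose that \<open>d = a b - b a\<close> is not in \<open>J = J(R)\<close>.  The cover principle for \<open>F = d R - J\<close> gives
  \<open>f \<in> F\<close> for which \<open>f R + J\<close> is simple modulo \<open>J\<close>.  As \<open>R / J\<close> is semiprime, \<open>f R + J\<close> is generated
  modulo \<open>J\<close> by an idempotent \<open>u \<in> f R\<close>.  But \<open>u\<close> is annihilated by \<open>L\<^sub>a\<close> like \<open>d\<close>, and thus
  nilpotent; an element that is both nilpotent and idempotent modulo \<open>J\<close> lies in \<open>J\<close>.
\<close>

lemma commutator_mem_jacobson_radical:
  assumes ce: "centrally_essential R" and cov: "has_simple_covers R"
    and a: "a \<in> carrier R" and b: "b \<in> carrier R"
  shows "a \<otimes> b \<ominus> b \<otimes> a \<in> jacobson_radical R"
proof (rule ccontr)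
  let ?J = "jacobson_radical R" and ?d = "a \<otimes> b \<ominus> b \<otimes> a"
  assume dJ: "?d \<notin> ?J"
  interpret J: ideal ?J R by (rule jacobson_radical_ideal)
  have J: "right_ideal R ?J" by (rule ideal_is_right_ideal[OF jacobson_radical_ideal])
  have d: "?d \<in> carrier R" using a b by simp
  define F where "F = (\<lambda>s. ?d \<otimes> s) ` carrier R - ?J"
  have "?d = ?d \<otimes> \<one>" using d by simp
  then have "?d \<in> F" unfolding F_def using dJ by blast
  then have "F \<subseteq> carrier R" "F \<noteq> {}" "F \<inter> ?J = {}" using d by (auto simp: F_def)
  from simple_cover_principle[OF cov J this]
  obtain N f where N: "?J \<subseteq> N" "F \<inter> N = {}" and fF: "f \<in> F"
    and max: "maximal_right_ideal {r \<in> carrier R. f \<otimes> r \<in> N} R" by blast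
  obtain s0 where s0: "s0 \<in> carrier R" "f = ?d \<otimes> s0" and fJ: "f \<notin> ?J"
    using fF by (auto simp: F_def)
  have f: "f \<in> carrier R" using s0 d by simp
  let ?P = "{r \<in> carrier R. f \<otimes> r \<in> ?J}"
  have "f \<otimes> r \<in> N \<longleftrightarrow> f \<otimes> r \<in> ?J" if r: "r \<in> carrier R" for r
  proof -
    have "f \<otimes> r = ?d \<otimes> (s0 \<otimes> r)" using s0 d r by (simp add: m_assoc)
    then have "f \<otimes> r \<in> F" if "f \<otimes> r \<notin> ?J" using that s0 r by (auto simp: F_def)
    then show ?thesis using N by blast
  qed
  then have P: "maximal_right_ideal ?P R" using max by (simp cong: conj_cong)
  \<comment> \<open>Semiprimeness: otherwise the right ideal \<open>f R\<close> would be nil, since \<open>(f r)\<^sup>2 \<in> J\<close>.\<close>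
  have "\<exists>s\<in>carrier R. f \<otimes> (s \<otimes> f) \<notin> ?J"
  proof (rule ccontr)
    assume fsf: "\<not> ?thesis"
    have "\<exists>n::nat. (f \<otimes> r) [^] n = \<zero>" if r: "r \<in> carrier R" for r
    proof -
      have "f \<otimes> (r \<otimes> f) \<otimes> r \<in> ?J" using fsf r J.I_r_closed by blast
      then have "(f \<otimes> r) [^] (2::nat) \<in> ?J"
        using f r by (simp add: numeral_2_eq_2 m_assoc)
      then obtain n :: nat where "((f \<otimes> r) [^] (2::nat)) [^] n = \<zero>"
        using jacobson_radical_nil[OF cov] by blast
      then have "(f \<otimes> r) [^] (2 * n) = \<zero>" using f r by (simp add: nat_pow_pow)
      then show ?thesis by blast
    qed
    then show False using mem_jacobson_radical_if_nil[OF f] fJ by blast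
  qed
  then obtain s where s: "s \<in> carrier R" "f \<otimes> (s \<otimes> f) \<notin> ?J" by blast
  have "s \<otimes> f \<in> carrier R" "s \<otimes> f \<notin> ?P" using s f by auto
  from maximal_right_ideal_comaximal[OF P this]
  obtain r where r: "r \<in> carrier R" "f \<otimes> (\<one> \<ominus> s \<otimes> f \<otimes> r) \<in> ?J" by blast
  \<comment> \<open>Modulo \<open>J\<close> one has \<open>f = f s f r\<close>, so \<open>u = f r s\<close> is a right unit for \<open>f s\<close>.\<close>
  define u where "u = f \<otimes> (r \<otimes> s)"
  have u: "u \<in> carrier R" using f r s by (simp add: u_def)
  have fs: "f \<otimes> s \<in> carrier R" using f s by simp
  have "f \<otimes> (\<one> \<ominus> s \<otimes> f \<otimes> r) \<otimes> s = f \<otimes> s \<ominus> f \<otimes> s \<otimes> u"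
    using f s r by (simp add: u_def a_minus_def l_distr r_distr l_minus r_minus m_assoc)
  then have fsu: "f \<otimes> s \<ominus> f \<otimes> s \<otimes> u \<in> ?J"
    using J.I_r_closed[OF r(2) s(1)] by simp
  \<comment> \<open>Left multiplication by \<open>f s\<close> is nonzero on the simple module \<open>(f R + J) / J\<close>, hence injective
    there; it kills \<open>u - u\<^sup>2\<close>, which is therefore in \<open>J\<close>.\<close>
  let ?Q = "{y \<in> carrier R. f \<otimes> s \<otimes> f \<otimes> y \<in> ?J}"
  have "?Q = ?P"
  proof -
    have "right_ideal R ?Q" using f fs by (intro right_ideal_quotient J) simp
    moreover have "?P \<subseteq> ?Q"
    proof
      fix y assume "y \<in> ?P"
      then have y: "y \<in> carrier R" "f \<otimes> y \<in> ?J" by auto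
      have "f \<otimes> s \<otimes> (f \<otimes> y) \<in> ?J" by (rule J.I_l_closed[OF y(2) fs])
      moreover have "f \<otimes> s \<otimes> (f \<otimes> y) = f \<otimes> s \<otimes> f \<otimes> y" by (rule m_assoc[symmetric, OF fs f y(1)])
      ultimately show "y \<in> ?Q" using y(1) by simp
    qed
    moreover have "\<one> \<notin> ?Q" using s f by (simp add: m_assoc)
    then have "?Q \<noteq> carrier R" using one_closed by blast
    moreover have "\<forall>H. right_ideal R H \<and> ?P \<subseteq> H \<longrightarrow> H = ?P \<or> H = carrier R"
      using P unfolding maximal_right_ideal_def by (elim conjE)
    ultimately show ?thesis by (metis (lifting))
  qed
  moreover have "r \<otimes> s \<ominus> r \<otimes> s \<otimes> u \<in> ?Q"
  proof -
    have "f \<otimes> s \<otimes> f \<otimes> (r \<otimes> s \<ominus> r \<otimes> s \<otimes> u) = (f \<otimes> s \<otimes> u) \<ominus> (f \<otimes> s \<otimes> u) \<otimes> u"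
      using f s(1) r(1) by (simp add: u_def a_minus_def r_distr r_minus m_assoc)
    also have "\<dots> = (f \<otimes> s \<ominus> f \<otimes> s \<otimes> u) \<otimes> u"
      using fs u by (simp add: a_minus_def l_distr l_minus)
    finally show ?thesis using J.I_r_closed[OF fsu u] f s(1) r(1) u by simp
  qed
  ultimately have "f \<otimes> (r \<otimes> s \<ominus> r \<otimes> s \<otimes> u) \<in> ?J" by blast
  moreover have "f \<otimes> (r \<otimes> s \<ominus> r \<otimes> s \<otimes> u) = u \<ominus> u \<otimes> u"
    using f s r u by (simp add: u_def a_minus_def r_distr r_minus m_assoc)
  ultimately have uu: "u \<ominus> u \<otimes> u \<in> ?J" by simp
  then obtain m :: nat where m: "(u \<ominus> u \<otimes> u) [^] m = \<zero>"
    using jacobson_radical_nil[OF cov] by blast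
  have "u \<otimes> z = \<zero>" if z: "z \<in> central_denominators a" for z
  proof -
    have zC: "z \<in> ring_center R" and zR: "z \<in> carrier R"
      using z by (auto simp: central_denominators_def center_closed)
    have x: "s0 \<otimes> (r \<otimes> s) \<in> carrier R" using s0 r s by simp
    have "u \<otimes> z = ?d \<otimes> (s0 \<otimes> (r \<otimes> s) \<otimes> z)"
      using s0 d r s zR by (simp add: u_def m_assoc)
    also have "\<dots> = ?d \<otimes> z \<otimes> (s0 \<otimes> (r \<otimes> s))"
      using center_commute[OF zC x] d zR x by (simp add: m_assoc)
    finally show ?thesis
      using commutator_central_denominator[OF a b z] x by simp
  qed
  from nilpotent_if_idempotent_mod_nil[OF ce a u this m]
  obtain q where q: "q \<in> carrier R" "(\<one> \<ominus> u) \<otimes> q = \<one>"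
    using one_minus_nilpotent[OF u] by blast
  have "u = (u \<ominus> u \<otimes> u) \<otimes> q"
  proof -
    have "u = u \<otimes> ((\<one> \<ominus> u) \<otimes> q)" using u q by simp
    also have "\<dots> = u \<otimes> (\<one> \<ominus> u) \<otimes> q" using u q(1) by (simp add: m_assoc)
    also have "u \<otimes> (\<one> \<ominus> u) = u \<ominus> u \<otimes> u" using u by (simp add: a_minus_def r_distr r_minus)
    finally show ?thesis .
  qed
  then have "u \<in> ?J" using J.I_r_closed[OF uu q(1)] by simp
  then have "f \<otimes> s \<otimes> u \<in> ?J" using J.I_l_closed fs by blast
  then have "(f \<otimes> s \<ominus> f \<otimes> s \<otimes> u) \<oplus> f \<otimes> s \<otimes> u \<in> ?J" using fsu by blast
  then have "f \<otimes> s \<in> ?J" using fs u by (simp add: a_minus_def a_assoc l_neg)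
  then show False using s f J.I_r_closed[of "f \<otimes> s" f] by (simp add: m_assoc)
qed

text \<open>
  If no \<open>a\<^sup>n (1 - a x)\<close> were in \<open>J = J(R)\<close>, let \<open>N\<close> avoid all of them, and let \<open>P\<close> be the maximal
  right ideal of those \<open>r\<close> with \<open>f r \<in> N\<close>, for some \<open>f = a\<^sup>n (1 - a x)\<close>.  If \<open>a \<in> P\<close>, then \<open>f a\<close>,
  which is \<open>a\<^sup>n\<^sup>+\<^sup>1 (1 - a x)\<close> modulo \<open>J\<close>, is in \<open>N\<close>; otherwise some \<open>1 - a y\<close> is in \<open>P\<close>, and
  \<open>f (1 - a y)\<close> is again of the form that \<open>N\<close> avoids.  So \<open>a\<^sup>n (1 - a x) \<in> J\<close> for some \<open>n\<close> and \<open>x\<close>;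
  and the exponent can be lowered to \<open>1\<close> since \<open>R / J\<close> is commutative and reduced.
\<close>

lemma regular_mod_jacobson_radical:
  assumes cov: "has_simple_covers R"
    and comm: "\<And>a b. a \<in> carrier R \<Longrightarrow> b \<in> carrier R \<Longrightarrow> a \<otimes> b \<ominus> b \<otimes> a \<in> jacobson_radical R"
    and a: "a \<in> carrier R"
  shows "\<exists>x\<in>carrier R. a \<ominus> a \<otimes> x \<otimes> a \<in> jacobson_radical R"
proof -
  let ?J = "jacobson_radical R"
  interpret J: ideal ?J R by (rule jacobson_radical_ideal)
  have J: "right_ideal R ?J" by (rule ideal_is_right_ideal[OF jacobson_radical_ideal])
  let ?F = "{a [^] n \<otimes> (\<one> \<ominus> a \<otimes> x) | (n::nat) x. x \<in> carrier R}"
  have "?F \<inter> ?J \<noteq> {}"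
  proof
    assume disj: "?F \<inter> ?J = {}"
    have sub: "?F \<subseteq> carrier R" using a by auto
    have ne: "?F \<noteq> {}" by blast
    from simple_cover_principle[OF cov J sub ne disj]
    obtain N f where N: "right_ideal R N" "?J \<subseteq> N" "?F \<inter> N = {}" and fF: "f \<in> ?F"
      and max: "maximal_right_ideal {r \<in> carrier R. f \<otimes> r \<in> N} R" by blast
    obtain n :: nat and x where x: "x \<in> carrier R" and f: "f = a [^] n \<otimes> (\<one> \<ominus> a \<otimes> x)"
      using fF by blast
    define p where "p = a [^] n"
    have p: "p \<in> carrier R" using a by (simp add: p_def)
    have f: "f = p \<otimes> (\<one> \<ominus> a \<otimes> x)" using f by (simp add: p_def)
    have fR: "f \<in> carrier R" using p a x f by simp
    show False
    proof (cases "f \<otimes> a \<in> N")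
      case True
      have "f \<otimes> a = p \<otimes> a \<ominus> p \<otimes> a \<otimes> (x \<otimes> a)"
        using p a x by (simp add: f a_minus_def l_distr r_distr l_minus r_minus m_assoc)
      moreover have "p \<otimes> a \<otimes> (x \<otimes> a \<ominus> a \<otimes> x) \<in> N"
        using J.I_l_closed[OF comm[OF x a], of "p \<otimes> a"] N(2) p a by auto
      ultimately have "(p \<otimes> a \<ominus> p \<otimes> a \<otimes> (x \<otimes> a)) \<oplus> p \<otimes> a \<otimes> (x \<otimes> a \<ominus> a \<otimes> x) \<in> N"
        using right_ideal_add[OF N(1)] True by simp
      also have "(p \<otimes> a \<ominus> p \<otimes> a \<otimes> (x \<otimes> a)) \<oplus> p \<otimes> a \<otimes> (x \<otimes> a \<ominus> a \<otimes> x)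
          = p \<otimes> a \<otimes> (\<one> \<ominus> a \<otimes> x)"
        using p a x by (simp add: a_minus_def r_distr r_minus a_assoc r_neg1)
      finally have "a [^] Suc n \<otimes> (\<one> \<ominus> a \<otimes> x) \<in> N" by (simp add: p_def)
      then show False using N(3) x by blast
    next
      case False
      then have "a \<notin> {r \<in> carrier R. f \<otimes> r \<in> N}" by simp
      from maximal_right_ideal_comaximal[OF max a this]
      obtain y where y: "y \<in> carrier R" "f \<otimes> (\<one> \<ominus> a \<otimes> y) \<in> N" by blast
      have "(\<one> \<ominus> a \<otimes> x) \<otimes> (\<one> \<ominus> a \<otimes> y) = \<one> \<ominus> a \<otimes> (x \<oplus> y \<ominus> x \<otimes> a \<otimes> y)"
        using a x y(1)
        by (simp add: a_minus_def l_distr r_distr l_minus r_minus m_assoc minus_add a_ac)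
      then have "f \<otimes> (\<one> \<ominus> a \<otimes> y) = p \<otimes> (\<one> \<ominus> a \<otimes> (x \<oplus> y \<ominus> x \<otimes> a \<otimes> y))"
        using f a x p y(1) by (simp add: m_assoc)
      then have "a [^] n \<otimes> (\<one> \<ominus> a \<otimes> (x \<oplus> y \<ominus> x \<otimes> a \<otimes> y)) \<in> N"
        using y by (simp add: p_def)
      moreover have "x \<oplus> y \<ominus> x \<otimes> a \<otimes> y \<in> carrier R" using a x y by simp
      ultimately show False using N(3) by blast
    qed
  qed
  then obtain n :: nat and x where x: "x \<in> carrier R" and nx: "a [^] n \<otimes> (\<one> \<ominus> a \<otimes> x) \<in> ?J"
    by blast
  \<comment> \<open>In the commutative quotient, \<open>a\<^sup>n e = 0\<close> makes all multiples of \<open>e a = a - a x a\<close> nilpotent; as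
    \<open>J\<close> is nil, they are nilpotent in \<open>R\<close>.\<close>
  define e where "e = \<one> \<ominus> a \<otimes> x"
  have e: "e \<in> carrier R" using a x by (simp add: e_def)
  have zeroQ: "\<zero>\<^bsub>R Quot ?J\<^esub> = ?J" by (simp only: FactRing_def ring.select_convs)
  interpret Q: cring "R Quot ?J" by (rule J.quotient_commutative) (rule comm)
  interpret h: ring_hom_ring R "R Quot ?J" "\<lambda>y. ?J +> y" by (rule J.rcos_ring_hom_ring)
  let ?h = "\<lambda>y. ?J +> y"
  have ker: "?h y = \<zero>\<^bsub>R Quot ?J\<^esub> \<longleftrightarrow> y \<in> ?J" if "y \<in> carrier R" for y
  proof -
    have "?h y = ?J \<longleftrightarrow> y \<in> ?J"
      by (rule iffI) (erule J.rcos_const_imp_mem[OF that], erule J.a_rcos_const)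
    then show ?thesis unfolding zeroQ .
  qed
  have pow: "?h (y [^] k) = ?h y [^]\<^bsub>R Quot ?J\<^esub> k" if "y \<in> carrier R" for y and k :: nat
    using that by (rule h.hom_nat_pow)
  have zero: "?h a [^]\<^bsub>R Quot ?J\<^esub> n \<otimes>\<^bsub>R Quot ?J\<^esub> ?h e = \<zero>\<^bsub>R Quot ?J\<^esub>"
    using nx ker[of "a [^] n \<otimes> e"] a e by (simp add: pow e_def[symmetric])
  have "(e \<otimes> a \<otimes> r) [^] Suc n \<in> ?J" if r: "r \<in> carrier R" for r
  proof -
    have "?h ((e \<otimes> a \<otimes> r) [^] Suc n) = (?h e \<otimes>\<^bsub>R Quot ?J\<^esub> ?h a \<otimes>\<^bsub>R Quot ?J\<^esub> ?h r) [^]\<^bsub>R Quot ?J\<^esub> Suc n"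
      using a e r by (simp only: pow m_closed h.hom_mult)
    also have "\<dots> = \<zero>\<^bsub>R Quot ?J\<^esub>"
      by (rule Q.nilpotent_mult_if_power_mult_zero[OF _ _ _ zero]) (simp_all only: a e r h.hom_closed)
    finally show ?thesis using ker[of "(e \<otimes> a \<otimes> r) [^] Suc n"] a e r by blast
  qed
  then have "\<exists>m::nat. (e \<otimes> a \<otimes> r) [^] m = \<zero>" if r: "r \<in> carrier R" for r
    using jacobson_radical_nil[OF cov] nat_pow_pow[of "e \<otimes> a \<otimes> r" "Suc n"] a e r
    by (metis m_closed)
  then have "e \<otimes> a \<in> ?J" using mem_jacobson_radical_if_nil[of "e \<otimes> a"] a e by simp
  moreover have "e \<otimes> a = a \<ominus> a \<otimes> x \<otimes> a"
    using a x by (simp add: e_def a_minus_def l_distr l_minus)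
  ultimately show ?thesis using x by metis
qed

proposition jacobson_radical_of_simple_covers:
  assumes "centrally_essential R" "has_simple_covers R"
  shows "nil_with_commutative_regular_quotient (jacobson_radical R) R"
  unfolding nil_with_commutative_regular_quotient_def
  using jacobson_radical_ideal jacobson_radical_nil[OF assms(2)]
    commutator_mem_jacobson_radical[OF assms]
    regular_mod_jacobson_radical[OF assms(2) commutator_mem_jacobson_radical[OF assms]]
  by blast

text \<open>
  Nil ideals lie in the Jacobson radical.  Conversely, for \<open>a \<in> J(R)\<close> regularity gives \<open>x\<close> with
  \<open>a (1 - x a) \<in> N\<close>, and \<open>1 - x a\<close> has a right inverse because \<open>x a \<in> J(R)\<close>.
\<close>

lemma nil_ideal_eq_jacobson_radical:
  assumes N: "nil_with_commutative_regular_quotient N R"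
  shows "N = jacobson_radical R"
proof -
  interpret N: ideal N R using N by (simp add: nil_with_commutative_regular_quotient_def)
  have nil: "\<exists>n::nat. x [^] n = \<zero>" if "x \<in> N" for x
    using N that unfolding nil_with_commutative_regular_quotient_def by blast
  have reg: "\<exists>x\<in>carrier R. a \<ominus> a \<otimes> x \<otimes> a \<in> N" if "a \<in> carrier R" for a
    using N that unfolding nil_with_commutative_regular_quotient_def by blast
  have "x \<in> jacobson_radical R" if x: "x \<in> N" for x
    using nil N.I_r_closed[OF x] x by (intro mem_jacobson_radical_if_nil) auto
  moreover have "a \<in> N" if aJ: "a \<in> jacobson_radical R" for a
  proof -
    interpret J: ideal "jacobson_radical R" R by (rule jacobson_radical_ideal)
    have a: "a \<in> carrier R" using aJ by simp
    obtain x where x: "x \<in> carrier R" "a \<ominus> a \<otimes> x \<otimes> a \<in> N" using reg[OF a] by blast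
    let ?K = "{\<zero> \<oplus> (\<one> \<ominus> x \<otimes> a) \<otimes> k | k. k \<in> carrier R}"
    have w: "\<one> \<ominus> x \<otimes> a \<in> carrier R" using a x by simp
    have zero: "right_ideal R {\<zero>}" by (rule right_idealI) auto
    have K: "right_ideal R ?K"
      using right_ideal_sum[OF zero right_ideal_carrier w] by simp
    have "\<one> \<in> ?K"
    proof (rule ccontr)
      assume "\<one> \<notin> ?K"
      then obtain M where M: "maximal_right_ideal M R" "?K \<subseteq> M"
        using exists_maximal_right_ideal[OF K] by blast
      have MR: "right_ideal R M" "M \<noteq> carrier R" using M(1) by (auto simp: maximal_right_ideal_def)
      have "\<one> \<ominus> x \<otimes> a = \<zero> \<oplus> (\<one> \<ominus> x \<otimes> a) \<otimes> \<one>" using w by simp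
      then have "\<one> \<ominus> x \<otimes> a \<in> M" using M(2) by blast
      moreover have "x \<otimes> a \<in> M"
        by (rule jacobson_radical_mem_maximal[OF J.I_l_closed[OF aJ x(1)] M(1)])
      ultimately have "(\<one> \<ominus> x \<otimes> a) \<oplus> x \<otimes> a \<in> M" by (rule right_ideal_add[OF MR(1)])
      then have "\<one> \<in> M" using a x by (simp add: a_minus_def a_assoc l_neg)
      then show False using right_ideal_eq_carrier MR by blast
    qed
    then obtain y where y: "y \<in> carrier R" "\<one> = (\<one> \<ominus> x \<otimes> a) \<otimes> y" using w by auto
    have "a = a \<otimes> ((\<one> \<ominus> x \<otimes> a) \<otimes> y)" using y(2) a by simp
    also have "\<dots> = a \<otimes> (\<one> \<ominus> x \<otimes> a) \<otimes> y" using a w y(1) by (simp add: m_assoc)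
    also have "a \<otimes> (\<one> \<ominus> x \<otimes> a) = a \<ominus> a \<otimes> x \<otimes> a"
      using a x by (simp add: a_minus_def r_distr r_minus m_assoc)
    finally show ?thesis using N.I_r_closed[OF x(2) y(1)] by simp
  qed
  ultimately show ?thesis by blast
qed

lemma quotient_by_jacobson_radical:
  assumes N: "nil_with_commutative_regular_quotient N R"
  shows "cring (R Quot jacobson_radical R) \<and> regular_ring (R Quot jacobson_radical R)"
proof -
  interpret N: ideal N R using N by (simp add: nil_with_commutative_regular_quotient_def)
  have "cring (R Quot N)"
    using N unfolding nil_with_commutative_regular_quotient_def
    by (intro N.quotient_commutative) blast
  moreover have "regular_ring (R Quot N)"
    unfolding regular_ring_def
  proof
    fix X assume "X \<in> carrier (R Quot N)"
    then obtain a where a: "a \<in> carrier R" "X = N +> a" unfolding N.quotient_carrier by blast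
    obtain x where x: "x \<in> carrier R" "a \<ominus> a \<otimes> x \<otimes> a \<in> N"
      using N a unfolding nil_with_commutative_regular_quotient_def by blast
    have "X = X \<otimes>\<^bsub>R Quot N\<^esub> (N +> x) \<otimes>\<^bsub>R Quot N\<^esub> X"
      using a x by (simp add: FactRing_def N.rcoset_mult_add N.coset_eq_iff)
    then show "\<exists>Y\<in>carrier (R Quot N). X = X \<otimes>\<^bsub>R Quot N\<^esub> Y \<otimes>\<^bsub>R Quot N\<^esub> X"
      using x(1) N.quotient_carrier by blast
  qed
  ultimately show ?thesis using nil_ideal_eq_jacobson_radical[OF N] by simp
qed

end


section \<open>Semi-Artinian rings have simple covers\<close>

text \<open>
  The factor module \<open>M / N\<close> is nonzero with essential socle, so it has a simple submodule \<open>S\<close>; the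
  cover \<open>T\<close> is the preimage of \<open>S\<close> under the projection \<open>\<pi>\<close>.
\<close>

lemma semiartinian_module_simple_cover:
  fixes M (structure)
  assumes M: "abelian_group M"
    and closed: "\<And>a x. a \<in> carrier R \<Longrightarrow> x \<in> carrier M \<Longrightarrow> a \<odot> x \<in> carrier M"
    and distr: "\<And>a x y. a \<in> carrier R \<Longrightarrow> x \<in> carrier M \<Longrightarrow> y \<in> carrier M \<Longrightarrow>
      a \<odot> (x \<oplus> y) = a \<odot> x \<oplus> a \<odot> y"
    and sa: "semiartinian_module R M"
    and N: "submodule N R M" and proper: "N \<noteq> carrier M"
  obtains T where "submodule T R M" "N \<subset> T"
    "\<forall>H. submodule H R M \<and> N \<subseteq> H \<and> H \<subseteq> T \<longrightarrow> H = N \<or> H = T"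
proof -
  interpret abelian_group M by (rule M)
  have Nsub: "subgroup N (add_monoid M)"
    and Nact: "\<And>a x. a \<in> carrier R \<Longrightarrow> x \<in> N \<Longrightarrow> a \<odot> x \<in> N"
    using N by (auto simp: submodule_def submodule_axioms_def)
  interpret N: abelian_subgroup N M
    by (rule abelian_subgroupI3[OF additive_subgroupI[OF Nsub] M])
  let ?F = "factor_module M N"
  define \<pi> where "\<pi> = (\<lambda>x. N +> x)"
  have zeroF: "\<zero>\<^bsub>?F\<^esub> = N" by (simp add: factor_module_def)
  have carF: "carrier ?F = \<pi> ` carrier M"
    by (auto simp: factor_module_def A_RCOSETS_def' \<pi>_def)
  have hom: "group_hom (add_monoid M) (add_monoid ?F) \<pi>"
  proof (intro group_hom.intro group_hom_axioms.intro a_group)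
    have "group (add_monoid ?F) \<longleftrightarrow> group (M A_Mod N)"
      by (simp add: group_def monoid_def group_axioms_def Units_def factor_module_def
          A_FactGroup_def')
    then show "group (add_monoid ?F)" using N.a_factorgroup_is_group by blast
    have "hom (add_monoid M) (add_monoid ?F) = hom (add_monoid M) (M A_Mod N)"
      by (simp add: hom_def factor_module_def A_FactGroup_def')
    then show "\<pi> \<in> hom (add_monoid M) (add_monoid ?F)"
      using N.a_r_coset_hom_A_Mod unfolding \<pi>_def by simp
  qed
  have act: "a \<odot>\<^bsub>?F\<^esub> \<pi> x = \<pi> (a \<odot> x)" if a: "a \<in> carrier R" and x: "x \<in> carrier M" for a x
  proof -
    have "N +> (a \<odot> y) = N +> (a \<odot> x)" if y: "y \<in> N +> x" for y
    proof -
      obtain n where n: "n \<in> N" "y = n \<oplus> x"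
        using y by (auto simp: a_r_coset_def')
      have "a \<odot> y = a \<odot> n \<oplus> a \<odot> x"
        using n distr[OF a _ x] N.a_subset by auto
      then have "a \<odot> y \<in> N +> (a \<odot> x)"
        using Nact[OF a n(1)] by (auto simp: a_r_coset_def')
      then show ?thesis
        using N.a_repr_independence'[OF _ closed[OF a x]] by simp
    qed
    moreover have "x \<in> N +> x" by (rule N.a_rcos_self[OF x])
    ultimately have "(\<Union>y\<in>N +> x. N +> (a \<odot> y)) = N +> (a \<odot> x)" by blast
    then show ?thesis by (simp add: factor_module_def \<pi>_def)
  qed
  have img: "submodule (\<pi> ` H) R ?F" if H: "submodule H R M" for H
  proof -
    have "subgroup H (add_monoid M)" and Hact: "\<And>a x. a \<in> carrier R \<Longrightarrow> x \<in> H \<Longrightarrow> a \<odot> x \<in> H"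
      and Hc: "H \<subseteq> carrier M"
      using H by (auto simp: submodule_def submodule_axioms_def subgroup_def)
    then have "subgroup (\<pi> ` H) (add_monoid ?F)"
      using group_hom.subgroup_img_is_subgroup[OF hom] by blast
    moreover have "a \<odot>\<^bsub>?F\<^esub> X \<in> \<pi> ` H" if "a \<in> carrier R" "X \<in> \<pi> ` H" for a X
      using that act Hact Hc by auto
    ultimately show ?thesis by (simp add: submodule_def submodule_axioms_def)
  qed
  have vimg: "submodule {x \<in> carrier M. \<pi> x \<in> S} R M" if S: "submodule S R ?F" for S
  proof -
    have S': "subgroup S (add_monoid ?F)" and Sact: "\<And>a x. a \<in> carrier R \<Longrightarrow> x \<in> S \<Longrightarrow> a \<odot>\<^bsub>?F\<^esub> x \<in> S"
      using S by (auto simp: submodule_def submodule_axioms_def)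
    interpret h: group_hom "add_monoid M" "add_monoid ?F" \<pi> by (rule hom)
    have "subgroup {x \<in> carrier M. \<pi> x \<in> S} (add_monoid M)"
    proof (rule add.subgroupI)
      have "\<pi> \<zero> \<in> S" using h.hom_one subgroup.one_closed[OF S'] by simp
      then show "{x \<in> carrier M. \<pi> x \<in> S} \<noteq> {}" by auto
      show "\<ominus> x \<in> {x \<in> carrier M. \<pi> x \<in> S}" if "x \<in> {x \<in> carrier M. \<pi> x \<in> S}" for x
        using that h.hom_inv[of x] subgroup.m_inv_closed[OF S', of "\<pi> x"] by (simp add: a_inv_def)
      show "x \<oplus> y \<in> {x \<in> carrier M. \<pi> x \<in> S}"
        if "x \<in> {x \<in> carrier M. \<pi> x \<in> S}" "y \<in> {x \<in> carrier M. \<pi> x \<in> S}" for x y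
        using that h.hom_mult[of x y] subgroup.m_closed[OF S', of "\<pi> x" "\<pi> y"] by simp
    qed auto
    then show ?thesis
      using closed Sact by (auto simp: submodule_def submodule_axioms_def simp flip: act)
  qed
  have self: "x \<in> \<pi> x" if "x \<in> carrier M" for x
    unfolding \<pi>_def by (rule N.a_rcos_self[OF that])
  have inN: "\<pi> x = N \<longleftrightarrow> x \<in> N" if "x \<in> carrier M" for x
    using self[OF that] N.a_rcos_const unfolding \<pi>_def by blast
  have "\<exists>S. simple_submodule S R ?F"
  proof (rule ccontr)
    assume "\<not> ?thesis"
    then have soc: "socle R ?F = \<Inter>{H. submodule H R ?F}" by (simp add: socle_def)
    have zero: "N \<in> H" if "submodule H R ?F" for H
      using that zeroF by (auto simp: submodule_def dest: subgroup.one_closed)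
    have "submodule (\<pi> ` N) R ?F" by (rule img[OF N])
    moreover have "\<pi> ` N \<subseteq> {N}" using inN N.a_subset by auto
    ultimately have "socle R ?F = {N}" unfolding soc using zero by blast
    moreover have "submodule (carrier M) R M"
      using closed by (simp add: submodule_def submodule_axioms_def add.subgroup_self)
    then have "submodule (carrier ?F) R ?F" unfolding carF by (rule img)
    moreover obtain x where "x \<in> carrier M" "x \<notin> N" using proper N.a_subset by blast
    then have "\<pi> x \<in> carrier ?F" "\<pi> x \<noteq> N" using inN carF by auto
    then have "carrier ?F \<noteq> {N}" by blast
    moreover have "essential_submodule (socle R ?F) R ?F"
      using sa N by (simp add: semiartinian_module_def)
    ultimately show False
      using zero[of "carrier ?F"] unfolding essential_submodule_def zeroF by blast
  qed
  then obtain S where S: "submodule S R ?F" "S \<noteq> {N}"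
    and min: "\<forall>H. submodule H R ?F \<and> H \<subseteq> S \<longrightarrow> H = {N} \<or> H = S"
    unfolding simple_submodule_def zeroF by auto
  have NS: "N \<in> S" and Sc: "S \<subseteq> carrier ?F"
    using S(1) zeroF by (auto simp: submodule_def subgroup_def)
  let ?T = "{x \<in> carrier M. \<pi> x \<in> S}"
  show ?thesis
  proof (rule that)
    show "submodule ?T R M" by (rule vimg[OF S(1)])
    have "N \<subseteq> ?T" using NS inN N.a_subset by auto
    moreover obtain x where "x \<in> carrier M" "\<pi> x \<in> S" "\<pi> x \<noteq> N"
      using S(2) NS Sc unfolding carF by blast
    then have "x \<in> ?T" "x \<notin> N" using inN by auto
    ultimately show "N \<subset> ?T" by blast
    show "\<forall>H. submodule H R M \<and> N \<subseteq> H \<and> H \<subseteq> ?T \<longrightarrow> H = N \<or> H = ?T"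
    proof (intro allI impI)
      fix H assume H: "submodule H R M \<and> N \<subseteq> H \<and> H \<subseteq> ?T"
      then have Hc: "H \<subseteq> carrier M" and Hadd: "\<And>x y. x \<in> H \<Longrightarrow> y \<in> H \<Longrightarrow> x \<oplus> y \<in> H"
        and NH: "N \<subseteq> H" and HT: "H \<subseteq> ?T"
        by (auto simp: submodule_def subgroup_def)
      have "submodule (\<pi> ` H) R ?F" "\<pi> ` H \<subseteq> S" using H img by auto
      then consider "\<pi> ` H = {N}" | "\<pi> ` H = S" using min by blast
      then show "H = N \<or> H = ?T"
      proof cases
        case 1
        have "h \<in> N" if "h \<in> H" for h
          using 1 that Hc inN[of h] by blast
        then show ?thesis using NH by blast
      next
        case 2
        have "t \<in> H" if t: "t \<in> carrier M" "\<pi> t \<in> S" for t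
        proof -
          obtain h where h: "h \<in> H" "\<pi> t = \<pi> h" using 2 t(2) by blast
          then obtain n where "n \<in> N" "t = n \<oplus> h"
            using self[OF t(1)] by (auto simp: \<pi>_def a_r_coset_def')
          then show ?thesis using NH h(1) Hadd by blast
        qed
        then show ?thesis using HT by blast
      qed
    qed
  qed
qed

context ring
begin

lemma has_simple_covers_if_right_semiartinian:
  assumes "right_semiartinian R"
  shows "has_simple_covers R"
  unfolding has_simple_covers_def
proof (intro allI impI)
  let ?M = "right_regular R"
  have simps: "carrier ?M = carrier R" "add ?M = add R" "\<And>a x. a \<odot>\<^bsub>?M\<^esub> x = x \<otimes> a"
    "zero ?M = \<zero>"
    by (simp_all add: right_regular_def)
  have M: "abelian_group ?M"
    by (rule abelian_groupI) (auto simp: simps a_ac intro: bexI[of _ "\<ominus> x" for x] l_neg)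
  fix N assume N: "right_ideal R N \<and> N \<noteq> carrier R"
  show "\<exists>T. right_ideal R T \<and> N \<subset> T \<and>
    (\<forall>H. right_ideal R H \<and> N \<subseteq> H \<and> H \<subseteq> T \<longrightarrow> H = N \<or> H = T)"
    by (rule semiartinian_module_simple_cover[OF M, of R N])
       (use N assms in \<open>auto simp: simps right_semiartinian_def l_distr\<close>)
qed

end


section \<open>The opposite ring\<close>

definition opposite_ring :: "('a, 'm) ring_scheme \<Rightarrow> ('a, 'm) ring_scheme" where
  "opposite_ring R = R\<lparr>mult := \<lambda>x y. y \<otimes>\<^bsub>R\<^esub> x\<rparr>"

lemma opposite_ring_simps [simp]:
  "carrier (opposite_ring R) = carrier R"
  "x \<otimes>\<^bsub>opposite_ring R\<^esub> y = y \<otimes>\<^bsub>R\<^esub> x"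
  "\<one>\<^bsub>opposite_ring R\<^esub> = \<one>\<^bsub>R\<^esub>"
  "\<zero>\<^bsub>opposite_ring R\<^esub> = \<zero>\<^bsub>R\<^esub>"
  "add (opposite_ring R) = add R"
  by (simp_all add: opposite_ring_def)

lemma opposite_ring_minus [simp]: "x \<ominus>\<^bsub>opposite_ring R\<^esub> y = x \<ominus>\<^bsub>R\<^esub> y"
  by (simp add: a_minus_def a_inv_def)

context ring
begin

lemma opposite_ring_is_ring: "ring (opposite_ring R)"
proof (rule ringI)
  show "abelian_group (opposite_ring R)"
    by (rule comm_group_abelian_groupI) (simp add: a_comm_group)
  show "monoid (opposite_ring R)"
    by (rule monoidI) (auto simp: m_assoc)
qed (auto simp: l_distr r_distr)

lemma opposite_ring_pow:
  assumes "x \<in> carrier R"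
  shows "x [^]\<^bsub>opposite_ring R\<^esub> (n::nat) = x [^] n"
proof -
  interpret O: ring "opposite_ring R" by (rule opposite_ring_is_ring)
  show ?thesis
  proof (induction n)
    case (Suc n)
    then show ?case using nat_pow_Suc2[OF assms] by simp
  qed simp
qed

lemma opposite_ring_centrally_essential:
  assumes "centrally_essential R"
  shows "centrally_essential (opposite_ring R)"
proof -
  have C: "ring_center (opposite_ring R) = ring_center R"
    by (auto simp: ring_center_def)
  show ?thesis
    unfolding centrally_essential_iff[OF opposite_ring_is_ring] C
    using assms[unfolded centrally_essential_iff[OF ring_axioms]]
    by (simp add: center_commute cong: bex_cong)
qed

text \<open>
  Right ideals of the opposite ring are the left ideals of \<open>R\<close>.
\<close>

lemma opposite_ring_has_simple_covers:
  assumes "left_semiartinian R"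
  shows "has_simple_covers (opposite_ring R)"
  unfolding has_simple_covers_def
proof (intro allI impI)
  let ?M = "left_regular R"
  have simps: "carrier ?M = carrier R" "add ?M = add R" "\<And>a x. a \<odot>\<^bsub>?M\<^esub> x = a \<otimes> x"
    "zero ?M = \<zero>"
    by (simp_all add: left_regular_def)
  have M: "abelian_group ?M"
    by (rule abelian_groupI) (auto simp: simps a_ac intro: bexI[of _ "\<ominus> x" for x] l_neg)
  have sub: "right_ideal (opposite_ring R) H \<longleftrightarrow> submodule H R ?M" for H
    by (simp add: submodule_right_regular_iff[OF opposite_ring_is_ring]
        submodule_left_regular_iff[OF ring_axioms] additive_subgroup_def)
  fix N assume N: "right_ideal (opposite_ring R) N \<and> N \<noteq> carrier (opposite_ring R)"
  show "\<exists>T. right_ideal (opposite_ring R) T \<and> N \<subset> T \<and>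
    (\<forall>H. right_ideal (opposite_ring R) H \<and> N \<subseteq> H \<and> H \<subseteq> T \<longrightarrow> H = N \<or> H = T)"
    unfolding sub
    by (rule semiartinian_module_simple_cover[OF M, of R N])
       (use N assms in \<open>auto simp: simps left_semiartinian_def r_distr sub\<close>)
qed

lemma nil_with_commutative_regular_quotient_opposite:
  assumes N: "nil_with_commutative_regular_quotient N (opposite_ring R)"
  shows "nil_with_commutative_regular_quotient N R"
proof -
  interpret O: ideal N "opposite_ring R"
    using N by (simp add: nil_with_commutative_regular_quotient_def)
  have sub: "N \<subseteq> carrier R" using O.a_subset by simp
  have "ideal N R"
    using O.additive_subgroup_axioms O.I_l_closed O.I_r_closed
    by (intro ideal.intro ideal_axioms.intro ring_axioms) (simp_all add: additive_subgroup_def)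
  moreover have "\<exists>n::nat. x [^] n = \<zero>" if "x \<in> N" for x
    using N that sub opposite_ring_pow unfolding nil_with_commutative_regular_quotient_def
    by (metis opposite_ring_simps(4) subsetD)
  moreover have "a \<otimes> b \<ominus> b \<otimes> a \<in> N" if "a \<in> carrier R" "b \<in> carrier R" for a b
    using N that unfolding nil_with_commutative_regular_quotient_def
    by (metis opposite_ring_minus opposite_ring_simps(1,2))
  moreover have "\<exists>x\<in>carrier R. a \<ominus> a \<otimes> x \<otimes> a \<in> N" if a: "a \<in> carrier R" for a
  proof -
    obtain x where "x \<in> carrier R" "a \<ominus> a \<otimes> (x \<otimes> a) \<in> N"
      using N a unfolding nil_with_commutative_regular_quotient_def by auto
    then show ?thesis using a by (auto simp: m_assoc)
  qed
  ultimately show ?thesis unfolding nil_with_commutative_regular_quotient_def by blast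
qed

proposition quotient_by_jacobson_radical_if_semiartinian:
  assumes ce: "centrally_essential R" and sa: "left_semiartinian R \<or> right_semiartinian R"
  shows "cring (R Quot jacobson_radical R) \<and> regular_ring (R Quot jacobson_radical R)"
  using sa
proof
  assume "right_semiartinian R"
  then show ?thesis
    using jacobson_radical_of_simple_covers[OF ce has_simple_covers_if_right_semiartinian]
      quotient_by_jacobson_radical by blast
next
  assume "left_semiartinian R"
  then have "nil_with_commutative_regular_quotient (jacobson_radical (opposite_ring R)) (opposite_ring R)"
    by (intro ring.jacobson_radical_of_simple_covers opposite_ring_is_ring
        opposite_ring_centrally_essential ce opposite_ring_has_simple_covers)
  then show ?thesis
    using nil_with_commutative_regular_quotient_opposite quotient_by_jacobson_radical by blast
qed

end


section \<open>A non-commutative algebra with a large center\<close>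

text \<open>
  A bilinear form \<open>\<beta>\<close> in four coordinates, whose basis vectors are called \<open>x\<close>, \<open>y\<close>, \<open>p\<close>, \<open>q\<close>, in
  the order of the indices \<open>{0}\<close>, \<open>{1}\<close>, \<open>{2}\<close>, \<open>{3}\<close>.  The term \<open>\<beta>(x, y)\<close> is the only one that is
  not symmetric, so it makes \<open>x\<close> and \<open>y\<close> non-commuting, while the symmetric pairs \<open>\<beta>(x, p)\<close> and
  \<open>\<beta>(y, q)\<close> let the central vectors \<open>p\<close> and \<open>q\<close> detect the coordinates at \<open>x\<close> and \<open>y\<close>.
\<close>

definition alg_form :: "(nat set \<Rightarrow> int) \<Rightarrow> (nat set \<Rightarrow> int) \<Rightarrow> int" where
  "alg_form f g = f {0} * g {1} + (f {0} * g {2} + f {2} * g {0}) + (f {1} * g {3} + f {3} * g {1})"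

text \<open>
  The index \<open>{}\<close> stands for the unit and \<open>{0, 1}\<close> for a vector \<open>s\<close> such that \<open>v w = \<beta>(v, w) s\<close> for all
  vectors \<open>v\<close>, \<open>w\<close> without unit component, \<open>\<beta>\<close> being \<^const>\<open>alg_form\<close>.  As \<open>s\<close> is in the radical
  of \<open>\<beta>\<close>, products of three such vectors vanish, and the multiplication is associative for every
  form of this kind.
\<close>

definition alg_mult :: "(nat set \<Rightarrow> int) \<Rightarrow> (nat set \<Rightarrow> int) \<Rightarrow> nat set \<Rightarrow> int" where
  "alg_mult f g = (\<lambda>S. if S = {} then f {} * g {}
     else f {} * g S + f S * g {} + (if S = {0, 1} then alg_form f g else 0))"

definition unit_vec :: "nat set \<Rightarrow> nat set \<Rightarrow> int" where
  "unit_vec T = (\<lambda>S. if S = T then 1 else 0)"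

lemma singleton_neq_01: "{k} \<noteq> {0, 1 :: nat}" "{0, 1 :: nat} \<noteq> {k}"
  by auto

lemma alg_mult_assoc: "alg_mult (alg_mult f g) h = alg_mult f (alg_mult g h)"
proof
  fix S :: "nat set"
  consider "S = {}" | "S = {0, 1}" | "S \<noteq> {}" "S \<noteq> {0, 1}" by blast
  then show "alg_mult (alg_mult f g) h S = alg_mult f (alg_mult g h) S"
    by cases (simp_all add: alg_mult_def alg_form_def singleton_neq_01 algebra_simps)
qed

lemma alg_mult_distrib:
  "alg_mult (\<lambda>S. f S + g S) h = (\<lambda>S. alg_mult f h S + alg_mult g h S)"
  "alg_mult h (\<lambda>S. f S + g S) = (\<lambda>S. alg_mult h f S + alg_mult h g S)"
  by (auto simp: alg_mult_def alg_form_def algebra_simps)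

lemma alg_mult_one: "alg_mult (unit_vec {}) f = f" "alg_mult f (unit_vec {}) = f"
  by (auto simp: alg_mult_def alg_form_def unit_vec_def)

lemma alg_mult_zero: "alg_mult (\<lambda>S. 0) f = (\<lambda>S. 0)" "alg_mult f (\<lambda>S. 0) = (\<lambda>S. 0)"
  by (auto simp: alg_mult_def alg_form_def)

text \<open>
  Commutators only see the antisymmetric part of the form.  In particular the central elements are
  those whose coordinates at \<open>{0}\<close> and \<open>{1}\<close> vanish.
\<close>

lemma alg_mult_commute_iff:
  "alg_mult f g = alg_mult g f \<longleftrightarrow> f {0} * g {1} = g {0} * f {1}"
proof -
  have "alg_mult f g = alg_mult g f \<longleftrightarrow> alg_form f g = alg_form g f"
    by (auto simp: alg_mult_def fun_eq_iff mult.commute)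
  also have "\<dots> \<longleftrightarrow> f {0} * g {1} = g {0} * f {1}"
    by (simp add: alg_form_def algebra_simps)
  finally show ?thesis .
qed

text \<open>
  The unit component is \<open>0\<close> or \<open>1\<close>.  In either case the equation in a coordinate other than \<open>{0, 1}\<close>
  makes it zero, then the form vanishes, and the coordinate at \<open>{0, 1}\<close> is zero as well.
\<close>

lemma alg_idempotent:
  assumes "alg_mult g g = g"
  shows "g = (\<lambda>S. 0) \<or> g = unit_vec {}"
proof -
  note eq = fun_cong[OF assms]
  have "g {} * g {} = g {}" using eq[of "{}"] by (simp add: alg_mult_def)
  then have e: "g {} = 0 \<or> g {} = 1" by simp
  have 1: "g S = 0" if S: "S \<noteq> {}" "S \<noteq> {0, 1}" for S
    using eq[of S] S e by (auto simp: alg_mult_def)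
  then have "alg_form g g = 0" by (simp add: alg_form_def singleton_neq_01)
  then have "g {0, 1} = 0" using eq[of "{0, 1}"] e by (auto simp: alg_mult_def)
  then have 0: "g S = 0" if "S \<noteq> {}" for S using 1 that by blast
  from e show ?thesis
  proof
    assume "g {} = 0"
    then have "g S = 0" for S using 0 by (cases "S = {}") simp_all
    then show ?thesis by blast
  next
    assume "g {} = 1"
    then have "g S = unit_vec {} S" for S using 0 by (cases "S = {}") (simp_all add: unit_vec_def)
    then show ?thesis by blast
  qed
qed


section \<open>Sequences with a constant tail\<close>

text \<open>
  Arbitrary entries are allowed at finitely many positions, but the constant tail has no component
  at \<open>p\<close> and \<open>q\<close>: the central elements that detect \<open>x\<close> and \<open>y\<close> are lost in the limit.
\<close>

definition tail_ring :: "(nat \<Rightarrow> nat set \<Rightarrow> int) ring" where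
  "tail_ring = \<lparr>
     carrier = {F. \<exists>g. g {2} = 0 \<and> g {3} = 0 \<and> (\<forall>\<^sub>F n in sequentially. F n = g)},
     mult = (\<lambda>F G n. alg_mult (F n) (G n)), one = (\<lambda>n. unit_vec {}),
     zero = (\<lambda>n S. 0), add = (\<lambda>F G n S. F n S + G n S)\<rparr>"

definition null_tail :: "(nat \<Rightarrow> nat set \<Rightarrow> int) set" where
  "null_tail = {F. \<forall>\<^sub>F n in sequentially. F n = (\<lambda>S. 0)}"

definition spike :: "nat \<Rightarrow> (nat set \<Rightarrow> int) \<Rightarrow> nat \<Rightarrow> nat set \<Rightarrow> int" where
  "spike k f = (\<lambda>n. if n = k then f else (\<lambda>S. 0))"

lemma tail_ring_simps:
  "mult tail_ring = (\<lambda>F G n. alg_mult (F n) (G n))" "one tail_ring = (\<lambda>n. unit_vec {})"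
  "zero tail_ring = (\<lambda>n S. 0)" "add tail_ring = (\<lambda>F G n S. F n S + G n S)"
  by (simp_all add: tail_ring_def)

lemma tail_ringI:
  "\<forall>\<^sub>F n in sequentially. F n = g \<Longrightarrow> g {2} = 0 \<Longrightarrow> g {3} = 0 \<Longrightarrow> F \<in> carrier tail_ring"
  by (auto simp: tail_ring_def)

lemma tail_ringE:
  assumes "F \<in> carrier tail_ring"
  obtains g where "\<forall>\<^sub>F n in sequentially. F n = g" "g {2} = 0" "g {3} = 0"
  using assms by (auto simp: tail_ring_def)

lemma const_in_tail_ring: "g {2} = 0 \<Longrightarrow> g {3} = 0 \<Longrightarrow> (\<lambda>n. g) \<in> carrier tail_ring"
  by (rule tail_ringI[of _ g]) auto

lemma null_tail_in_tail_ring: "null_tail \<subseteq> carrier tail_ring"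
  by (auto simp: null_tail_def intro: tail_ringI)

lemma spike_in_null_tail: "spike k f \<in> null_tail"
  unfolding null_tail_def spike_def eventually_sequentially mem_Collect_eq
  by (rule exI[of _ "Suc k"]) simp

lemma tail_ring_is_ring: "ring tail_ring"
proof (rule ringI)
  have add: "F \<oplus>\<^bsub>tail_ring\<^esub> G \<in> carrier tail_ring"
    and mult: "F \<otimes>\<^bsub>tail_ring\<^esub> G \<in> carrier tail_ring"
    if F: "F \<in> carrier tail_ring" and G: "G \<in> carrier tail_ring" for F G
  proof -
    obtain f where f: "\<forall>\<^sub>F n in sequentially. F n = f" "f {2} = 0" "f {3} = 0"
      by (rule tail_ringE[OF F])
    obtain g where g: "\<forall>\<^sub>F n in sequentially. G n = g" "g {2} = 0" "g {3} = 0"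
      by (rule tail_ringE[OF G])
    have "\<forall>\<^sub>F n in sequentially. (F \<oplus>\<^bsub>tail_ring\<^esub> G) n = (\<lambda>S. f S + g S)"
      using f(1) g(1) by eventually_elim (simp add: tail_ring_simps)
    then show "F \<oplus>\<^bsub>tail_ring\<^esub> G \<in> carrier tail_ring"
      by (rule tail_ringI) (simp_all add: f g)
    have "\<forall>\<^sub>F n in sequentially. (F \<otimes>\<^bsub>tail_ring\<^esub> G) n = alg_mult f g"
      using f(1) g(1) by eventually_elim (simp add: tail_ring_simps)
    then show "F \<otimes>\<^bsub>tail_ring\<^esub> G \<in> carrier tail_ring"
      by (rule tail_ringI) (simp_all add: f g alg_mult_def singleton_neq_01)
  qed
  have zero: "\<zero>\<^bsub>tail_ring\<^esub> \<in> carrier tail_ring"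
    unfolding tail_ring_simps by (rule const_in_tail_ring) auto
  have one: "\<one>\<^bsub>tail_ring\<^esub> \<in> carrier tail_ring"
    unfolding tail_ring_simps by (rule const_in_tail_ring) (auto simp: unit_vec_def)
  show "abelian_group tail_ring"
  proof (rule abelian_groupI)
    fix F assume F: "F \<in> carrier tail_ring"
    obtain f where f: "\<forall>\<^sub>F n in sequentially. F n = f" "f {2} = 0" "f {3} = 0"
      by (rule tail_ringE[OF F])
    have "\<forall>\<^sub>F n in sequentially. (\<lambda>S. - F n S) = (\<lambda>S. - f S)"
      using f(1) by eventually_elim simp
    then have "(\<lambda>n S. - F n S) \<in> carrier tail_ring"
      by (rule tail_ringI) (simp_all add: f)
    then show "\<exists>G\<in>carrier tail_ring. G \<oplus>\<^bsub>tail_ring\<^esub> F = \<zero>\<^bsub>tail_ring\<^esub>"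
      by (rule bexI[rotated]) (simp add: tail_ring_simps)
  qed (auto simp: add zero, auto simp: tail_ring_simps ac_simps)
  show "monoid tail_ring"
    by (rule monoidI) (auto simp: mult one, auto simp: tail_ring_simps alg_mult_assoc alg_mult_one)
qed (auto simp: tail_ring_simps alg_mult_distrib)

interpretation T: ring tail_ring
  by (rule tail_ring_is_ring)

lemma tail_ring_minus:
  assumes F: "F \<in> carrier tail_ring" and G: "G \<in> carrier tail_ring"
  shows "F \<ominus>\<^bsub>tail_ring\<^esub> G = (\<lambda>n S. F n S - G n S)"
proof -
  let ?D = "F \<ominus>\<^bsub>tail_ring\<^esub> G"
  have "?D \<oplus>\<^bsub>tail_ring\<^esub> G = F"
    using F G by (simp add: a_minus_def T.a_assoc T.l_neg)
  then have "?D n S + G n S = F n S" for n S by (auto simp: tail_ring_simps dest!: fun_cong)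
  then show ?thesis by (auto simp: fun_eq_iff algebra_simps)
qed

lemma tail_ring_central:
  assumes F: "F \<in> carrier tail_ring" and z: "\<And>n. F n {0} = 0" "\<And>n. F n {1} = 0"
  shows "F \<in> ring_center tail_ring"
  using F z by (auto simp: ring_center_def tail_ring_simps alg_mult_commute_iff fun_eq_iff
    intro: fun_cong[OF alg_mult_commute_iff[THEN iffD2]])

text \<open>
  An entry with nonzero coordinate at \<open>x\<close> or \<open>y\<close> is multiplied by \<open>p\<close> or \<open>q\<close> at its own position, which
  moves that coordinate to the central vector \<open>s\<close>.
\<close>

lemma tail_ring_centrally_essential: "centrally_essential tail_ring"
  unfolding centrally_essential_iff[OF tail_ring_is_ring]
proof (intro ballI impI)
  fix F assume F: "F \<in> carrier tail_ring" "F \<noteq> \<zero>\<^bsub>tail_ring\<^esub>"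
  show "\<exists>c\<in>ring_center tail_ring. F \<otimes>\<^bsub>tail_ring\<^esub> c \<noteq> \<zero>\<^bsub>tail_ring\<^esub> \<and>
    F \<otimes>\<^bsub>tail_ring\<^esub> c \<in> ring_center tail_ring"
  proof (cases "\<forall>n. F n {0} = 0 \<and> F n {1} = 0")
    case True
    then have "F \<in> ring_center tail_ring" using tail_ring_central F by blast
    then show ?thesis
      using F by (intro bexI[of _ "\<one>\<^bsub>tail_ring\<^esub>"]) (auto simp: T.one_center)
  next
    case False
    then obtain n k where n: "F n {k} \<noteq> 0" and k: "k = 0 \<or> k = 1" by auto
    \<comment> \<open>The index \<open>k + 2\<close> turns \<open>x\<close> into \<open>p\<close> and \<open>y\<close> into \<open>q\<close>.\<close>
    let ?c = "spike n (unit_vec {k + 2})"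
    have cC: "?c \<in> ring_center tail_ring"
      using spike_in_null_tail null_tail_in_tail_ring
      by (intro tail_ring_central) (auto simp: spike_def unit_vec_def)
    have "(F \<otimes>\<^bsub>tail_ring\<^esub> ?c) n {0, 1} = F n {k}"
      using k by (auto simp: tail_ring_simps alg_mult_def alg_form_def spike_def unit_vec_def
          singleton_neq_01)
    then have "F \<otimes>\<^bsub>tail_ring\<^esub> ?c \<noteq> \<zero>\<^bsub>tail_ring\<^esub>"
      using n by (metis tail_ring_simps(3))
    moreover have "F \<otimes>\<^bsub>tail_ring\<^esub> ?c \<in> ring_center tail_ring"
    proof (rule tail_ring_central)
      show "F \<otimes>\<^bsub>tail_ring\<^esub> ?c \<in> carrier tail_ring"
        using F T.center_closed[OF cC] by simp
    qed (auto simp: tail_ring_simps alg_mult_def spike_def unit_vec_def singleton_neq_01)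
    ultimately show ?thesis using cC by blast
  qed
qed

lemma null_tail_ideal: "ideal null_tail tail_ring"
proof -
  have "right_ideal tail_ring null_tail"
  proof (rule T.right_idealI[OF null_tail_in_tail_ring])
    show "\<zero>\<^bsub>tail_ring\<^esub> \<in> null_tail" by (simp add: null_tail_def tail_ring_simps)
    show "F \<oplus>\<^bsub>tail_ring\<^esub> G \<in> null_tail" if "F \<in> null_tail" "G \<in> null_tail" for F G
      using that unfolding null_tail_def mem_Collect_eq
      by eventually_elim (simp add: tail_ring_simps)
    show "F \<otimes>\<^bsub>tail_ring\<^esub> G \<in> null_tail" if "F \<in> null_tail" for F G
      using that unfolding null_tail_def mem_Collect_eq
      by eventually_elim (simp add: tail_ring_simps alg_mult_zero)
  qed
  moreover have "G \<otimes>\<^bsub>tail_ring\<^esub> F \<in> null_tail" if "F \<in> null_tail" for F G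
    using that unfolding null_tail_def mem_Collect_eq
    by eventually_elim (simp add: tail_ring_simps alg_mult_zero)
  ultimately show ?thesis
    by (intro ideal.intro ideal_axioms.intro tail_ring_is_ring)
       (auto simp: submodule_right_regular_iff[OF tail_ring_is_ring])
qed

text \<open>
  A sequence supported on finitely many positions is a finite sum of its products with the
  idempotents of these positions.
\<close>

lemma null_tail_generated: "null_tail = Idl\<^bsub>tail_ring\<^esub> (range (\<lambda>k. spike k (unit_vec {})))"
  (is "_ = Idl\<^bsub>_\<^esub> ?E")
proof
  have E: "?E \<subseteq> null_tail" using spike_in_null_tail by blast
  show "Idl\<^bsub>tail_ring\<^esub> ?E \<subseteq> null_tail"
    by (rule T.genideal_minimal[OF null_tail_ideal E])
  have Ec: "?E \<subseteq> carrier tail_ring" using E null_tail_in_tail_ring by blast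
  interpret I: ideal "Idl\<^bsub>tail_ring\<^esub> ?E" tail_ring by (rule T.genideal_ideal[OF Ec])
  have gen: "F \<in> Idl\<^bsub>tail_ring\<^esub> ?E" if "\<forall>n\<ge>m. F n = (\<lambda>S. 0)" for F m
    using that
  proof (induction m arbitrary: F)
    case 0
    then have "F = \<zero>\<^bsub>tail_ring\<^esub>" by (auto simp: tail_ring_simps)
    then show ?case by simp
  next
    case (Suc m)
    let ?e = "spike m (unit_vec {})"
    have "F \<in> null_tail"
      using Suc.prems by (auto simp: null_tail_def eventually_sequentially)
    then have "F \<in> carrier tail_ring" using null_tail_in_tail_ring by blast
    then have "F \<otimes>\<^bsub>tail_ring\<^esub> ?e \<in> Idl\<^bsub>tail_ring\<^esub> ?E"
      using T.genideal_self[OF Ec] by (intro I.I_l_closed) auto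
    moreover have "F(m := (\<lambda>S. 0)) \<in> Idl\<^bsub>tail_ring\<^esub> ?E"
      using Suc.prems by (intro Suc.IH) (auto simp: le_Suc_eq not_less_eq_eq)
    moreover have "F = F(m := (\<lambda>S. 0)) \<oplus>\<^bsub>tail_ring\<^esub> F \<otimes>\<^bsub>tail_ring\<^esub> ?e"
      by (auto simp: fun_eq_iff tail_ring_simps spike_def alg_mult_one alg_mult_zero)
    ultimately show ?case by (metis I.a_closed)
  qed
  show "null_tail \<subseteq> Idl\<^bsub>tail_ring\<^esub> ?E"
    using gen by (auto simp: null_tail_def eventually_sequentially)
qed

lemma spike_central_idempotent:
  "spike k (unit_vec {}) \<in> ring_center tail_ring \<inter> idempotents tail_ring"
proof -
  have "spike k (unit_vec {}) \<in> carrier tail_ring"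
    using spike_in_null_tail null_tail_in_tail_ring by blast
  moreover have "spike k (unit_vec {}) \<in> ring_center tail_ring"
    by (rule tail_ring_central) (use calculation in \<open>auto simp: spike_def unit_vec_def\<close>)
  ultimately show ?thesis
    by (auto simp: idempotents_def tail_ring_simps spike_def alg_mult_one alg_mult_zero)
qed

lemma tail_coset_eq_iff:
  assumes "F \<in> carrier tail_ring" "G \<in> carrier tail_ring"
  shows "null_tail +>\<^bsub>tail_ring\<^esub> F = null_tail +>\<^bsub>tail_ring\<^esub> G \<longleftrightarrow>
    (\<forall>\<^sub>F n in sequentially. F n = G n)"
  using ideal.coset_eq_iff[OF null_tail_ideal assms] tail_ring_minus[OF assms]
  by (simp add: null_tail_def fun_eq_iff)

lemma tail_quotient_zero: "\<zero>\<^bsub>tail_ring Quot null_tail\<^esub> = null_tail +>\<^bsub>tail_ring\<^esub> (\<lambda>n S. 0)"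
  using T.a_rcos_zero[OF null_tail_ideal, of "\<lambda>n S. 0"] by (simp add: FactRing_def null_tail_def)

lemma tail_quotient_mult:
  assumes "F \<in> carrier tail_ring" "G \<in> carrier tail_ring"
  shows "(null_tail +>\<^bsub>tail_ring\<^esub> F) \<otimes>\<^bsub>tail_ring Quot null_tail\<^esub> (null_tail +>\<^bsub>tail_ring\<^esub> G)
    = null_tail +>\<^bsub>tail_ring\<^esub> (\<lambda>n. alg_mult (F n) (G n))"
  using ideal.rcoset_mult_add[OF null_tail_ideal assms] by (simp add: FactRing_def tail_ring_simps)

lemma tail_quotient_cases:
  assumes "X \<in> carrier (tail_ring Quot null_tail)"
  obtains g where "g {2} = 0" "g {3} = 0" "X = null_tail +>\<^bsub>tail_ring\<^esub> (\<lambda>n. g)"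
proof -
  obtain F where F: "F \<in> carrier tail_ring" "X = null_tail +>\<^bsub>tail_ring\<^esub> F"
    using assms unfolding ideal.quotient_carrier[OF null_tail_ideal] by blast
  obtain g where g: "\<forall>\<^sub>F n in sequentially. F n = g" "g {2} = 0" "g {3} = 0"
    by (rule tail_ringE[OF F(1)])
  then have "X = null_tail +>\<^bsub>tail_ring\<^esub> (\<lambda>n. g)"
    using F tail_coset_eq_iff[OF F(1) const_in_tail_ring] by simp
  then show ?thesis using that g by blast
qed

lemma tail_quotient_idempotents:
  "idempotents (tail_ring Quot null_tail) \<subseteq>
    {\<zero>\<^bsub>tail_ring Quot null_tail\<^esub>, \<one>\<^bsub>tail_ring Quot null_tail\<^esub>}"
proof
  fix X assume X: "X \<in> idempotents (tail_ring Quot null_tail)"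
  then obtain g where g: "g {2} = 0" "g {3} = 0" "X = null_tail +>\<^bsub>tail_ring\<^esub> (\<lambda>n. g)"
    by (auto simp: idempotents_def elim: tail_quotient_cases)
  have c: "(\<lambda>n. g) \<in> carrier tail_ring" using g const_in_tail_ring by blast
  have "X \<otimes>\<^bsub>tail_ring Quot null_tail\<^esub> X = X" using X by (simp add: idempotents_def)
  then have "null_tail +>\<^bsub>tail_ring\<^esub> (\<lambda>n. alg_mult g g) = null_tail +>\<^bsub>tail_ring\<^esub> (\<lambda>n. g)"
    using g(3) tail_quotient_mult[OF c c] by simp
  then have "alg_mult g g = g"
    using tail_coset_eq_iff[OF T.m_closed[OF c c] c] by (simp add: tail_ring_simps)
  then have "g = (\<lambda>S. 0) \<or> g = unit_vec {}" by (rule alg_idempotent)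
  then show "X \<in> {\<zero>\<^bsub>tail_ring Quot null_tail\<^esub>, \<one>\<^bsub>tail_ring Quot null_tail\<^esub>}"
    using g(3) tail_quotient_zero by (auto simp: FactRing_def tail_ring_simps)
qed

text \<open>
  The quotient is the algebra of the possible tails.  An element of its center has no components at
  \<open>x\<close> and \<open>y\<close>, and as \<open>p\<close> is absent, it multiplies \<open>x\<close> to a scalar multiple of \<open>x\<close>, which is
  central only if it is zero.
\<close>

lemma tail_quotient_not_centrally_essential:
  "\<not> centrally_essential (tail_ring Quot null_tail)"
proof
  let ?Q = "tail_ring Quot null_tail"
  let ?h = "\<lambda>g. null_tail +>\<^bsub>tail_ring\<^esub> (\<lambda>n :: nat. g)"
  let ?x = "unit_vec {0}" and ?y = "unit_vec {1}"
  note frame = const_in_tail_ring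
  assume "centrally_essential ?Q"
  note ce = this[unfolded centrally_essential_iff[OF ideal.quotient_is_ring[OF null_tail_ideal]], rule_format]
  have car: "?h g \<in> carrier ?Q" if "g {2} = 0" "g {3} = 0" for g
    using frame[OF that] unfolding ideal.quotient_carrier[OF null_tail_ideal] by blast
  have eq: "?h f = ?h g \<longleftrightarrow> f = g" if "f {2} = 0" "f {3} = 0" "g {2} = 0" "g {3} = 0" for f g :: "nat set \<Rightarrow> int"
    using tail_coset_eq_iff[OF frame frame] that by simp
  have mult: "?h f \<otimes>\<^bsub>?Q\<^esub> ?h g = ?h (alg_mult f g)"
    if "f {2} = 0" "f {3} = 0" "g {2} = 0" "g {3} = 0" for f g :: "nat set \<Rightarrow> int"
    using tail_quotient_mult[OF frame frame] that by simp
  have tail: "alg_mult f g {2} = 0" "alg_mult f g {3} = 0"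
    if "f {2} = 0" "f {3} = 0" "g {2} = 0" "g {3} = 0" for f g :: "nat set \<Rightarrow> int"
    using that by (auto simp: alg_mult_def singleton_neq_01)
  have central: "g {0} * f {1} = f {0} * g {1}"
    if "?h g \<in> ring_center ?Q" "f {2} = 0" "f {3} = 0" "g {2} = 0" "g {3} = 0" for f g :: "nat set \<Rightarrow> int"
  proof -
    have "?h g \<otimes>\<^bsub>?Q\<^esub> ?h f = ?h f \<otimes>\<^bsub>?Q\<^esub> ?h g"
      using that(1) car[OF that(2,3)] unfolding ring_center_def by blast
    then have "alg_mult g f = alg_mult f g"
      using that eq tail by (simp add: mult)
    then show ?thesis by (simp add: alg_mult_commute_iff)
  qed
  have xy: "?x {2} = 0" "?x {3} = 0" "?y {2} = 0" "?y {3} = 0" by (simp_all add: unit_vec_def)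
  have zero: "\<zero>\<^bsub>?Q\<^esub> = ?h (\<lambda>S. 0)" by (rule tail_quotient_zero)
  have "?x \<noteq> (\<lambda>S. 0)" by (auto simp: unit_vec_def fun_eq_iff)
  then have "?h ?x \<noteq> \<zero>\<^bsub>?Q\<^esub>" unfolding zero using xy by (simp add: eq)
  from ce[OF car[OF xy(1,2)] this] obtain c
    where c: "c \<in> ring_center ?Q" "?h ?x \<otimes>\<^bsub>?Q\<^esub> c \<noteq> \<zero>\<^bsub>?Q\<^esub>" "?h ?x \<otimes>\<^bsub>?Q\<^esub> c \<in> ring_center ?Q"
    by blast
  then have "c \<in> carrier ?Q" by (simp add: ring_center_def)
  then obtain g where g: "g {2} = 0" "g {3} = 0" "c = ?h g"
    by (rule tail_quotient_cases)
  have "g {0} = 0" "g {1} = 0"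
    using central[of g ?x] central[of g ?y] c(1) g xy by (auto simp: unit_vec_def)
  have xg: "?h ?x \<otimes>\<^bsub>?Q\<^esub> c = ?h (alg_mult ?x g)" using g xy by (simp add: mult)
  have "g {} = 0"
    using central[of "alg_mult ?x g" ?y] c(3) xy g tail[OF xy(1,2) g(1,2)]
    unfolding xg by (simp add: unit_vec_def alg_mult_def singleton_neq_01)
  then have "alg_mult ?x g = (\<lambda>S. 0)"
    using \<open>g {0} = 0\<close> \<open>g {1} = 0\<close> g(1,2)
    by (auto simp: alg_mult_def alg_form_def unit_vec_def)
  then show False using c(2) unfolding xg zero by simp
qed

lemma null_tail_proper: "null_tail \<noteq> carrier tail_ring"
proof -
  have "unit_vec {} \<noteq> (\<lambda>S. 0)" by (auto simp: unit_vec_def fun_eq_iff)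
  then have "\<one>\<^bsub>tail_ring\<^esub> \<notin> null_tail" by (simp add: null_tail_def tail_ring_simps)
  then show ?thesis using T.one_closed by blast
qed


section \<open>The theorem on centrally essential rings\<close>

theorem theorem1p5:
  shows
    "(\<forall>R :: ('a, 'm) ring_scheme.
        ring R \<and> centrally_essential R \<and> (left_semiartinian R \<or> right_semiartinian R) \<longrightarrow>
        cring (R Quot jacobson_radical R) \<and> regular_ring (R Quot jacobson_radical R))
   \<and> (\<forall>R :: ('a, 'm) ring_scheme.
        ring R \<and> centrally_essential R \<and>
        (right_nonsingular R \<or> semiprime_ring (center_ring R)) \<longrightarrow> cring R)
   \<and> (\<exists>(R :: (nat \<Rightarrow> nat set \<Rightarrow> int) ring) B E.
        ring R \<and> centrally_essential R \<and>
        E \<subseteq> ring_center R \<inter> idempotents R \<and> B = Idl\<^bsub>R\<^esub> E \<and> B \<noteq> carrier R \<and>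
        idempotents (R Quot B) \<subseteq> {\<zero>\<^bsub>R Quot B\<^esub>, \<one>\<^bsub>R Quot B\<^esub>} \<and>
        \<not> centrally_essential (R Quot B))"
proof (intro conjI allI impI)
  fix R :: "('a, 'm) ring_scheme"
  assume "ring R \<and> centrally_essential R \<and> (left_semiartinian R \<or> right_semiartinian R)"
  then show "cring (R Quot jacobson_radical R)" "regular_ring (R Quot jacobson_radical R)"
    using ring.quotient_by_jacobson_radical_if_semiartinian by blast+
next
  fix R :: "('a, 'm) ring_scheme"
  assume R: "ring R \<and> centrally_essential R \<and>
    (right_nonsingular R \<or> semiprime_ring (center_ring R))"
  then interpret ring R by simp
  have "c = \<zero>\<^bsub>R\<^esub>" if "c \<in> ring_center R" "c \<otimes>\<^bsub>R\<^esub> c = \<zero>\<^bsub>R\<^esub>" for c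
    using R that center_reduced_if_right_nonsingular center_reduced_if_semiprime by blast
  then show "cring R" using R commutative_if_center_reduced by blast
next
  let ?E = "range (\<lambda>k. spike k (unit_vec {}))"
  have "?E \<subseteq> ring_center tail_ring \<inter> idempotents tail_ring"
    using spike_central_idempotent by blast
  then show "\<exists>(R :: (nat \<Rightarrow> nat set \<Rightarrow> int) ring) B E.
        ring R \<and> centrally_essential R \<and>
        E \<subseteq> ring_center R \<inter> idempotents R \<and> B = Idl\<^bsub>R\<^esub> E \<and> B \<noteq> carrier R \<and>
        idempotents (R Quot B) \<subseteq> {\<zero>\<^bsub>R Quot B\<^esub>, \<one>\<^bsub>R Quot B\<^esub>} \<and>
        \<not> centrally_essential (R Quot B)"
    using tail_ring_is_ring tail_ring_centrally_essential null_tail_generated null_tail_proper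
      tail_quotient_idempotents tail_quotient_not_centrally_essential by blast
qed

end
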